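(* Every $n$-qubit circuit consisting of Clifford gates and $N$ non-Clifford $Z$-phase gates can be implemented (up to global phase) by a circuit on $n$ qubits consisting of single-qubit unitaries and at most $2N+O(n^2/\log(n))$ untargeted $\mathrm{GMS}$ gates.
   Context: For a set $Q$ of qubits and a real $\alpha$, the global M\o{}lmer-S\o{}rensen gate is $\mathrm{GMS}_Q(\alpha)=\exp\bigl(-i\frac{\alpha}{4}\sum_{i\neq j\in Q}X_iX_j\bigr)=\prod_{i<j\in Q}\exp(-i\frac{\alpha}{2}X_iX_j)$, where the sum is over ordered pairs of distinct elements of $Q$ and $X_i$ is the Pauli $X$ on qubit $i$. "Untargeted" means that every $\mathrm{GMS}$ gate used must act on the set $Q$ of all $n$ qubits of the circuit (with any angle $\alpha$). The $Z$-phase gate with angle $\alpha\in[0,2\pi]$ on qubit $i$ is $Z_i(\alpha)=\exp(-i\frac{\alpha}{2}Z_i)$, with $Z_i$ the Pauli $Z$ on qubit $i$; it is non-Clifford if $\alpha\neq k\frac{\pi}{2}$ for all $k\in\mathbb{Z}$. The Clifford gates in the input circuit are $S=\mathrm{diag}(1,i)$, Hadamard, CNOT and CZ gates. The number of Clifford gates in the input circuit, and of single-qubit unitaries in the output circuit, is unrestricted. The $O(\cdot)$ term means: bounded by $C\,n^2/\log(n)$ for all $n\ge 2$, with $C$ an absolute constant independent of $n$, $N$ and the circuit. *)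

theory Defs
  imports "HOL-Analysis.Analysis" "Jordan_Normal_Form.Schur_Decomposition"
    "Jordan_Normal_Form.Jordan_Normal_Form"
begin

text \<open>The state space of \<open>n\<close> qubits, numbered \<open>0, \<dots>, n - 1\<close>, has dimension \<open>2 ^ n\<close>; the basis
  vector with index \<open>r\<close> is the computational basis state in which qubit \<open>q\<close> has the value \<open>bit r q\<close>.\<close>

definition unitary_mat :: "nat \<Rightarrow> complex mat \<Rightarrow> bool" where
  "unitary_mat d U \<longleftrightarrow> U \<in> carrier_mat d d \<and> mat_adjoint U * U = 1\<^sub>m d \<and> U * mat_adjoint U = 1\<^sub>m d"

text \<open>The matrix exponential, as an entrywise power series. It converges absolutely for every square
  matrix, see \<open>summable_mat_exp\<close> below.\<close>

definition mat_exp :: "complex mat \<Rightarrow> complex mat" where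
  "mat_exp A = mat (dim_row A) (dim_col A) (\<lambda>(r, c). \<Sum>k. (A ^\<^sub>m k) $$ (r, c) / fact k)"

lemma summable_mat_exp:
  assumes A: "A \<in> carrier_mat d d" and r: "r < d" and c: "c < d"
  shows "summable (\<lambda>k. norm ((A ^\<^sub>m k) $$ (r, c) / (fact k :: complex)))"
proof -
  obtain b where b: "norm_bound A b" using norm_bound_max by blast
  have "norm (A $$ (r, c)) \<le> b" using b A r c by (auto simp: norm_bound_def)
  then have b0: "0 \<le> b" using norm_ge_zero order_trans by blast
  have bnd: "norm_bound (A ^\<^sub>m k) ((1 + b * real d) ^ k)" for k
  proof (induction k)
    case 0
    show ?case using A by (auto simp: norm_bound_def)
  next
    case (Suc k)
    have "norm_bound (A ^\<^sub>m k * A) ((1 + b * real d) ^ k * b * real d)"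
      using norm_bound_mult[OF pow_carrier_mat[OF A] A Suc b] by simp
    moreover have "(1 + b * real d) ^ k * b * real d \<le> (1 + b * real d) ^ Suc k"
    proof -
      have "0 \<le> (1 + b * real d) ^ k" using b0 by simp
      moreover have "(1 + b * real d) ^ Suc k = (1 + b * real d) ^ k + (1 + b * real d) ^ k * b * real d"
        by (simp add: algebra_simps)
      ultimately show ?thesis by linarith
    qed
    ultimately show ?case
      unfolding norm_bound_def pow_mat.simps(2) using order_trans by blast
  qed
  have le: "norm ((A ^\<^sub>m k) $$ (r, c) / (fact k :: complex)) \<le> (1 + b * real d) ^ k / fact k" for k
  proof -
    have "norm ((A ^\<^sub>m k) $$ (r, c)) \<le> (1 + b * real d) ^ k"
      using bnd[of k] carrier_matD[OF pow_carrier_mat[OF A, of k]] r c unfolding norm_bound_def by metis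
    then show ?thesis by (simp add: norm_divide divide_right_mono)
  qed
  have sm: "summable (\<lambda>k. (1 + b * real d) ^ k / fact k)"
    using summable_exp[of "1 + b * real d"] by (simp only: divide_inverse mult.commute)
  show ?thesis by (rule summable_comparison_test'[OF sm, where N = 0]) (use le in simp)
qed

text \<open>\<open>U\<close> on qubit \<open>q\<close>, tensored with the identity on the other qubits.\<close>

definition on_qubit :: "nat \<Rightarrow> nat \<Rightarrow> complex mat \<Rightarrow> complex mat" where
  "on_qubit n q U = mat (2 ^ n) (2 ^ n) (\<lambda>(r, c).
     if \<forall>p<n. p \<noteq> q \<longrightarrow> bit r p = bit c p then U $$ (of_bool (bit r q), of_bool (bit c q)) else 0)"

definition pauli_X :: "complex mat" where
  "pauli_X = mat_of_rows_list 2 [[0, 1], [1, 0]]"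

definition pauli_Z :: "complex mat" where
  "pauli_Z = mat_of_rows_list 2 [[1, 0], [0, -1]]"

definition S_mat :: "complex mat" where
  "S_mat = mat_of_rows_list 2 [[1, 0], [0, \<i>]]"

definition hadamard :: "complex mat" where
  "hadamard = complex_of_real (1 / sqrt 2) \<cdot>\<^sub>m mat_of_rows_list 2 [[1, 1], [1, -1]]"

definition cnot_mat :: "nat \<Rightarrow> nat \<Rightarrow> nat \<Rightarrow> complex mat" where
  "cnot_mat n ctl tgt = mat (2 ^ n) (2 ^ n) (\<lambda>(r, c).
     of_bool (r = (if bit c ctl then flip_bit tgt c else c)))"

definition cz_mat :: "nat \<Rightarrow> nat \<Rightarrow> nat \<Rightarrow> complex mat" where
  "cz_mat n p q = mat (2 ^ n) (2 ^ n) (\<lambda>(r, c).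
     if r = c then (if bit c p \<and> bit c q then -1 else 1) else 0)"

definition zphase_mat :: "nat \<Rightarrow> nat \<Rightarrow> real \<Rightarrow> complex mat" where
  "zphase_mat n q \<alpha> = mat_exp ((- \<i> * complex_of_real (\<alpha> / 2)) \<cdot>\<^sub>m on_qubit n q pauli_Z)"

text \<open>The sum of \<open>X\<^sub>i X\<^sub>j\<close> over the ordered pairs of distinct elements of \<open>Q\<close>.\<close>

definition XX_sum :: "nat \<Rightarrow> nat set \<Rightarrow> complex mat" where
  "XX_sum n Q = mat (2 ^ n) (2 ^ n) (\<lambda>(r, c).
     \<Sum>(i, j) \<in> {(i, j). i \<in> Q \<and> j \<in> Q \<and> i \<noteq> j}. (on_qubit n i pauli_X * on_qubit n j pauli_X) $$ (r, c))"

definition gms_mat :: "nat \<Rightarrow> nat set \<Rightarrow> real \<Rightarrow> complex mat" where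
  "gms_mat n Q \<alpha> = mat_exp ((- \<i> * complex_of_real (\<alpha> / 4)) \<cdot>\<^sub>m XX_sum n Q)"

datatype gate =
    S_gate nat
  | H_gate nat
  | CNOT nat nat
  | CZ nat nat
  | ZPhase nat real
  | Single nat "complex mat"
  | GMS "nat set" real

fun gate_mat :: "nat \<Rightarrow> gate \<Rightarrow> complex mat" where
  "gate_mat n (S_gate q) = on_qubit n q S_mat"
| "gate_mat n (H_gate q) = on_qubit n q hadamard"
| "gate_mat n (CNOT p q) = cnot_mat n p q"
| "gate_mat n (CZ p q) = cz_mat n p q"
| "gate_mat n (ZPhase q \<alpha>) = zphase_mat n q \<alpha>"
| "gate_mat n (Single q U) = on_qubit n q U"
| "gate_mat n (GMS Q \<alpha>) = gms_mat n Q \<alpha>"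

fun valid_gate :: "nat \<Rightarrow> gate \<Rightarrow> bool" where
  "valid_gate n (S_gate q) \<longleftrightarrow> q < n"
| "valid_gate n (H_gate q) \<longleftrightarrow> q < n"
| "valid_gate n (CNOT p q) \<longleftrightarrow> p < n \<and> q < n \<and> p \<noteq> q"
| "valid_gate n (CZ p q) \<longleftrightarrow> p < n \<and> q < n \<and> p \<noteq> q"
| "valid_gate n (ZPhase q \<alpha>) \<longleftrightarrow> q < n \<and> 0 \<le> \<alpha> \<and> \<alpha> \<le> 2 * pi"
| "valid_gate n (Single q U) \<longleftrightarrow> q < n \<and> unitary_mat 2 U"
| "valid_gate n (GMS Q \<alpha>) \<longleftrightarrow> Q \<subseteq> {..<n}"

type_synonym circuit = "gate list"

definition valid_circuit :: "nat \<Rightarrow> circuit \<Rightarrow> bool" where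
  "valid_circuit n gs \<longleftrightarrow> (\<forall>g \<in> set gs. valid_gate n g)"

text \<open>The head of the list is the gate that is applied first.\<close>

fun circuit_mat :: "nat \<Rightarrow> circuit \<Rightarrow> complex mat" where
  "circuit_mat n [] = 1\<^sub>m (2 ^ n)"
| "circuit_mat n (g # gs) = circuit_mat n gs * gate_mat n g"

definition equal_up_to_phase :: "complex mat \<Rightarrow> complex mat \<Rightarrow> bool" where
  "equal_up_to_phase A B \<longleftrightarrow> (\<exists>\<theta>. A = cis \<theta> \<cdot>\<^sub>m B)"

definition implements :: "nat \<Rightarrow> circuit \<Rightarrow> circuit \<Rightarrow> bool" where
  "implements n gs hs \<longleftrightarrow> equal_up_to_phase (circuit_mat n gs) (circuit_mat n hs)"

fun clifford_gate :: "gate \<Rightarrow> bool" where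
  "clifford_gate (S_gate q) \<longleftrightarrow> True"
| "clifford_gate (H_gate q) \<longleftrightarrow> True"
| "clifford_gate (CNOT p q) \<longleftrightarrow> True"
| "clifford_gate (CZ p q) \<longleftrightarrow> True"
| "clifford_gate _ \<longleftrightarrow> False"

fun non_clifford_phase :: "gate \<Rightarrow> bool" where
  "non_clifford_phase (ZPhase q \<alpha>) \<longleftrightarrow> (\<forall>k::int. \<alpha> \<noteq> real_of_int k * (pi / 2))"
| "non_clifford_phase _ \<longleftrightarrow> False"

fun single_qubit_unitary :: "gate \<Rightarrow> bool" where
  "single_qubit_unitary (Single q U) \<longleftrightarrow> True"
| "single_qubit_unitary _ \<longleftrightarrow> False"

fun untargeted_gms :: "nat \<Rightarrow> gate \<Rightarrow> bool" where
  "untargeted_gms n (GMS Q \<alpha>) \<longleftrightarrow> Q = {..<n}"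
| "untargeted_gms n _ \<longleftrightarrow> False"

definition clifford_phase_circuit :: "nat \<Rightarrow> nat \<Rightarrow> circuit \<Rightarrow> bool" where
  "clifford_phase_circuit n N gs \<longleftrightarrow> valid_circuit n gs \<and>
     (\<forall>g \<in> set gs. clifford_gate g \<or> non_clifford_phase g) \<and>
     length (filter non_clifford_phase gs) = N"

definition untargeted_gms_circuit :: "nat \<Rightarrow> circuit \<Rightarrow> bool" where
  "untargeted_gms_circuit n gs \<longleftrightarrow> valid_circuit n gs \<and>
     (\<forall>g \<in> set gs. single_qubit_unitary g \<or> untargeted_gms n g)"

definition gms_count :: "nat \<Rightarrow> circuit \<Rightarrow> nat" where
  "gms_count n gs = length (filter (untargeted_gms n) gs)"

end

theory Submission
  imports Defs
begin

text \<open>In the eigenbasis of the \<open>X\<^sub>i\<close> the global gate with angle \<open>\<alpha>\<close> is, up to phase,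
  \<open>exp (- \<i> \<alpha> s\<^sup>2 / 4)\<close>, where \<open>s\<close> is the sum of all spins. Split the qubits into \<open>A\<close> and \<open>B\<close> with
  partial spin sums \<open>a\<close> and \<open>b\<close>. Conjugating by \<open>X\<close> on \<open>B\<close> turns \<open>s = a + b\<close> into \<open>a - b\<close>, and
  \<open>(a + b)\<^sup>2 - (a - b)\<^sup>2 = 4 a b\<close>, so two global gates with angles \<open>\<pi>/4\<close> and \<open>-\<pi>/4\<close> give \<open>exp (- \<i> \<pi> a b / 4)\<close>,
  which up to one-qubit gates is the product of all controlled-Z gates between \<open>A\<close> and \<open>B\<close>.
  When \<open>B\<close> is the support of a Pauli operator without one qubit \<open>v\<close>, this layer and one-qubit
  Clifford gates map the operator to \<open>X\<close> on \<open>v\<close>.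

  Move all Clifford gates through the circuit towards its end. Each phase gate becomes the exponential
  of a Pauli operator, and one layer \<open>V\<close> makes it a one-qubit gate. Only \<open>V\<close>, not its inverse, is paid for:
  the inverse is absorbed into the Clifford operator that is moved along. This gives \<open>2 N\<close>
  global gates and one remaining Clifford operator.

  A Clifford operator needs only \<open>O(n)\<close> global gates, which is within the claimed \<open>O(n\<^sup>2 / log n)\<close>: if the Pauli
  operators \<open>P\<close> and \<open>T\<close> anticommute and square to 1, the rotation \<open>(1 + P T) / sqrt 2\<close> maps \<open>P\<close> to \<open>T\<close>, costs
  four global gates and fixes every Pauli operator that commutes with \<open>P T\<close>. With at most two such rotations
  each, the images of \<open>Z\<^sub>q\<close> and \<open>X\<^sub>q\<close> are brought back to \<open>Z\<^sub>q\<close> and \<open>X\<^sub>q\<close>, one qubit after the other, and an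
  operator that commutes with all \<open>X\<^sub>q\<close> and \<open>Z\<^sub>q\<close> is a scalar.\<close>

section \<open>Adjoints and unitary matrices\<close>

lemma mat_adjoint_dim [simp]: "dim_row (mat_adjoint A) = dim_col A" "dim_col (mat_adjoint A) = dim_row A"
  unfolding mat_adjoint_def by auto

lemma mat_adjoint_carrier: "A \<in> carrier_mat m n \<Longrightarrow> mat_adjoint A \<in> carrier_mat n m"
  by auto

lemma mat_adjoint_index [simp]:
  fixes A :: "complex mat"
  assumes "i < dim_col A" "j < dim_row A"
  shows "mat_adjoint A $$ (i, j) = cnj (A $$ (j, i))"
  using assms unfolding mat_adjoint_def by (simp add: mat_of_rows_index cols_def)

lemma mat_adjoint_smult: "mat_adjoint (c \<cdot>\<^sub>m A) = cnj c \<cdot>\<^sub>m mat_adjoint A" for A :: "complex mat"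
  by (rule eq_matI) auto

lemma mat_adjoint_one: "mat_adjoint (1\<^sub>m d :: complex mat) = 1\<^sub>m d"
  by (rule eq_matI) auto

lemma mat_adjoint_adjoint: "mat_adjoint (mat_adjoint A) = A" for A :: "complex mat"
  by (rule eq_matI) auto

lemma mat_adjoint_mult:
  fixes A B :: "complex mat"
  assumes "A \<in> carrier_mat m n" "B \<in> carrier_mat n k"
  shows "mat_adjoint (A * B) = mat_adjoint B * mat_adjoint A"
  using assms by (intro eq_matI) (auto simp: scalar_prod_def mult.commute intro!: sum.cong)

lemma mat_mult_index_sum:
  "A \<in> carrier_mat m n \<Longrightarrow> B \<in> carrier_mat n k \<Longrightarrow> i < m \<Longrightarrow> j < k \<Longrightarrow>
    (A * B) $$ (i, j) = (\<Sum>l<n. A $$ (i, l) * B $$ (l, j))"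
  by (auto simp: scalar_prod_def atLeast0LessThan)

lemma unitary_matD:
  assumes "unitary_mat d U"
  shows "U \<in> carrier_mat d d" "mat_adjoint U \<in> carrier_mat d d"
    "mat_adjoint U * U = 1\<^sub>m d" "U * mat_adjoint U = 1\<^sub>m d"
  using assms by (auto simp: unitary_mat_def)

lemma unitary_mat_one: "unitary_mat d (1\<^sub>m d)"
  by (simp add: unitary_mat_def mat_adjoint_one)

lemma unitary_mat_adjoint: "unitary_mat d U \<Longrightarrow> unitary_mat d (mat_adjoint U)"
  by (auto simp: unitary_mat_def mat_adjoint_adjoint)

text \<open>Cancels an adjacent inverse pair in a fourfold product; used for products of unitaries
  and of conjugates.\<close>

lemma mat_cancel_mid:
  fixes A :: "complex mat"
  assumes "A \<in> carrier_mat d d" "B \<in> carrier_mat d d" "C \<in> carrier_mat d d" "D \<in> carrier_mat d d"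
    "B * C = 1\<^sub>m d"
  shows "(A * B) * (C * D) = A * D"
proof -
  have "(A * B) * (C * D) = A * (B * C) * D"
    using assms(1-4) by (simp add: assoc_mult_mat[of _ d d _ d _ d] mult_carrier_mat[of _ d d _ d])
  then show ?thesis using assms by simp
qed

lemma unitary_mat_mult:
  assumes U: "unitary_mat d U" and V: "unitary_mat d V"
  shows "unitary_mat d (U * V)"
proof -
  note u = unitary_matD[OF U] and v = unitary_matD[OF V]
  have "mat_adjoint (U * V) = mat_adjoint V * mat_adjoint U"
    using u v by (simp add: mat_adjoint_mult[of _ d d _ d])
  then show ?thesis
    unfolding unitary_mat_def using u v by (simp add: mat_cancel_mid[of _ d])
qed

lemma unitary_mat_smult:
  assumes U: "unitary_mat d U" and c: "cmod c = 1"
  shows "unitary_mat d (c \<cdot>\<^sub>m U)"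
proof -
  note u = unitary_matD[OF U]
  have "c * cnj c = 1" using c by (metis complex_norm_square of_real_1 power_one)
  moreover from this have "cnj c * c = 1" by (simp only: mult.commute)
  ultimately have cc: "c \<cdot>\<^sub>m (cnj c \<cdot>\<^sub>m 1\<^sub>m d) = 1\<^sub>m d" "cnj c \<cdot>\<^sub>m (c \<cdot>\<^sub>m 1\<^sub>m d) = 1\<^sub>m d"
    by (auto intro!: eq_matI)
  then show ?thesis
    unfolding unitary_mat_def using u
    by (simp add: mat_adjoint_smult mult_smult_distrib[of _ d d _ d]
        mult_smult_assoc_mat[of _ d d _ d] cc)
qed

text \<open>Inverses are unique, so exhibiting a right inverse of a unitary matrix identifies its
  adjoint.\<close>

lemma mat_adjoint_eqI:
  assumes U: "unitary_mat d U" and V: "V \<in> carrier_mat d d" and UV: "U * V = 1\<^sub>m d"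
  shows "mat_adjoint U = V"
proof -
  note u = unitary_matD[OF U]
  have "mat_adjoint U = mat_adjoint U * (U * V)" using UV right_mult_one_mat[OF u(2)] by simp
  also have "\<dots> = V" using u V by (simp add: assoc_mult_mat[of _ d d _ d _ d, symmetric])
  finally show ?thesis .
qed

section \<open>Tensor products of one-qubit operators\<close>

text \<open>The Kronecker product written entrywise: bit \<open>q\<close> of the row and of the
  column index selects the entry of \<open>U q\<close>, so qubit 0 is the least significant
  factor.\<close>

definition tensor :: "nat \<Rightarrow> (nat \<Rightarrow> complex mat) \<Rightarrow> complex mat" where
  "tensor n U = mat (2 ^ n) (2 ^ n) (\<lambda>(r, c). \<Prod>q<n. U q $$ (of_bool (bit r q), of_bool (bit c q)))"

definition diagm :: "nat \<Rightarrow> (nat \<Rightarrow> complex) \<Rightarrow> complex mat" where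
  "diagm n d = mat (2 ^ n) (2 ^ n) (\<lambda>(r, c). if r = c then d r else 0)"

lemma tensor_carrier [simp]: "tensor n U \<in> carrier_mat (2 ^ n) (2 ^ n)"
  and diagm_carrier [simp]: "diagm n d \<in> carrier_mat (2 ^ n) (2 ^ n)"
  and on_qubit_carrier [simp]: "on_qubit n q V \<in> carrier_mat (2 ^ n) (2 ^ n)"
  by (simp_all add: tensor_def diagm_def on_qubit_def)

lemma tensor_dim [simp]: "dim_row (tensor n U) = 2 ^ n" "dim_col (tensor n U) = 2 ^ n"
  by (simp_all add: tensor_def)

lemma tensor_index: "r < 2 ^ n \<Longrightarrow> c < 2 ^ n \<Longrightarrow>
    tensor n U $$ (r, c) = (\<Prod>q<n. U q $$ (of_bool (bit r q), of_bool (bit c q)))"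
  by (simp add: tensor_def)

text \<open>The distributive law, with the choices of summands coded as the bits of
  \<open>k\<close>. The induction splits the range by its top bit. This is what makes sums over
  basis states factor over the qubits.\<close>

lemma sum_prod_bits:
  fixes f :: "nat \<Rightarrow> bool \<Rightarrow> 'a::comm_semiring_1"
  shows "(\<Sum>k<(2::nat) ^ n. \<Prod>q<n. f q (bit k q)) = (\<Prod>q<n. f q False + f q True)"
proof (induction n)
  case (Suc n)
  have split: "{..<2 ^ Suc n} = {..<2 ^ n} \<union> (\<lambda>k. k + 2 ^ n) ` {..<(2::nat) ^ n}"
  proof (intro equalityI subsetI)
    fix x assume "x \<in> {..<(2::nat) ^ Suc n}"
    then have "x < 2 ^ n \<or> x = (x - 2 ^ n) + 2 ^ n \<and> x - 2 ^ n < 2 ^ n"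
      unfolding power_Suc lessThan_iff by linarith
    then show "x \<in> {..<2 ^ n} \<union> (\<lambda>k. k + 2 ^ n) ` {..<2 ^ n}" by blast
  qed auto
  \<comment> \<open>Dividing by \<open>2 ^ q\<close> turns the added \<open>2 ^ n\<close> into
    \<open>2 ^ (n - q)\<close>, which is even because \<open>q < n\<close>, so the parity that
    defines bit \<open>q\<close> is unchanged.\<close>
  have b1: "bit (k + 2 ^ n) q = bit k q" if "q < n" for k q :: nat
  proof -
    have "(2::nat) ^ n = 2 ^ q * 2 ^ (n - q)" using that by (simp flip: power_add)
    then have "(k + 2 ^ n) div 2 ^ q = k div 2 ^ q + 2 ^ (n - q)" by simp
    then show ?thesis using that by (simp add: bit_iff_odd)
  qed
  have b2: "bit (k + 2 ^ n) n" "\<not> bit k n" if "k < 2 ^ n" for k :: nat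
    using that by (auto simp: bit_iff_odd)
  have "(\<Sum>k<2 ^ Suc n. \<Prod>q<Suc n. f q (bit (k::nat) q)) =
     (\<Sum>k<2 ^ n. \<Prod>q<Suc n. f q (bit (k::nat) q)) + (\<Sum>k<2 ^ n. \<Prod>q<Suc n. f q (bit (k + 2 ^ n::nat) q))"
    unfolding split by (subst sum.union_disjoint) (auto simp: sum.reindex)
  also have "(\<Sum>k<2 ^ n. \<Prod>q<Suc n. f q (bit (k::nat) q)) = (\<Sum>k<2 ^ n. (\<Prod>q<n. f q (bit (k::nat) q)) * f n False)"
    using b2 by (intro sum.cong) auto
  also have "(\<Sum>k<2 ^ n. \<Prod>q<Suc n. f q (bit (k + 2 ^ n::nat) q)) = (\<Sum>k<2 ^ n. (\<Prod>q<n. f q (bit (k::nat) q)) * f n True)"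
    using b1 b2 by (intro sum.cong) auto
  finally show ?case using Suc by (simp add: sum_distrib_right[symmetric] distrib_left)
qed simp

lemma bits_eq_iff:
  assumes "r < 2 ^ n" "c < (2::nat) ^ n"
  shows "(\<forall>q<n. bit r q = bit c q) \<longleftrightarrow> r = c"
proof
  assume *: "\<forall>q<n. bit r q = bit c q"
  have "take_bit n r = r" "take_bit n c = c" using assms by (auto simp: take_bit_nat_eq_self)
  then show "r = c" using * by (intro bit_eqI) (metis bit_take_bit_iff)
qed simp

lemma mat2_mult_index:
  "A \<in> carrier_mat 2 2 \<Longrightarrow> B \<in> carrier_mat 2 2 \<Longrightarrow> i < 2 \<Longrightarrow> j < 2 \<Longrightarrow>
    (A * B) $$ (i, j) = A $$ (i, 0) * B $$ (0, j) + A $$ (i, 1) * B $$ (1, j)"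
  by (auto simp: scalar_prod_def numeral_2_eq_2)

text \<open>The sum over the intermediate basis state factors qubit by qubit through
  \<open>sum_prod_bits\<close>, and each factor is a two-term matrix product.\<close>

lemma tensor_mult:
  assumes "\<And>q. q < n \<Longrightarrow> U q \<in> carrier_mat 2 2" "\<And>q. q < n \<Longrightarrow> V q \<in> carrier_mat 2 2"
  shows "tensor n U * tensor n V = tensor n (\<lambda>q. U q * V q)"
proof (rule eq_matI)
  fix r c assume "r < dim_row (tensor n (\<lambda>q. U q * V q))" "c < dim_col (tensor n (\<lambda>q. U q * V q))"
  then have rc: "r < 2 ^ n" "c < 2 ^ n" by (auto simp: tensor_def)
  have "(tensor n U * tensor n V) $$ (r, c) =
      (\<Sum>k<(2::nat) ^ n. (\<Prod>q<n. U q $$ (of_bool (bit r q), of_bool (bit k q))) *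
        (\<Prod>q<n. V q $$ (of_bool (bit k q), of_bool (bit c q))))"
    using rc by (subst mat_mult_index_sum[OF tensor_carrier tensor_carrier]) (auto simp: tensor_index)
  also have "\<dots> = (\<Sum>k<(2::nat) ^ n. (\<Prod>q<n. U q $$ (of_bool (bit r q), of_bool (bit k q)) * V q $$ (of_bool (bit k q), of_bool (bit c q))))"
    by (simp add: prod.distrib)
  also have "\<dots> = (\<Prod>q<n. U q $$ (of_bool (bit r q), 0) * V q $$ (0, of_bool (bit c q)) +
       U q $$ (of_bool (bit r q), 1) * V q $$ (1, of_bool (bit c q)))"
    by (subst sum_prod_bits[where f = "\<lambda>q b. U q $$ (of_bool (bit r q), of_bool b) * V q $$ (of_bool b, of_bool (bit c q))"]) simp
  also have "\<dots> = tensor n (\<lambda>q. U q * V q) $$ (r, c)"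
    using rc assms by (auto simp: tensor_index mat2_mult_index intro!: prod.cong simp del: index_mult_mat)
  finally show "(tensor n U * tensor n V) $$ (r, c) = tensor n (\<lambda>q. U q * V q) $$ (r, c)" .
qed (auto simp: tensor_def)

lemma tensor_cong: "(\<And>q. q < n \<Longrightarrow> U q = V q) \<Longrightarrow> tensor n U = tensor n V"
  by (simp add: tensor_def)

lemma prod_of_bool: "finite A \<Longrightarrow> (\<Prod>q\<in>A. of_bool (P q)) = (of_bool (\<forall>q\<in>A. P q) :: 'a :: comm_semiring_1)"
  by (induction A rule: finite_induct) auto

lemma one_mat_of_bool: "(1\<^sub>m 2 :: complex mat) $$ (of_bool a, of_bool b) = of_bool (a = b)"
  by (cases a; cases b; simp)

lemma tensor_one: "tensor n (\<lambda>_. 1\<^sub>m 2) = 1\<^sub>m (2 ^ n)"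
proof (rule eq_matI)
  fix r c assume "r < dim_row (1\<^sub>m (2 ^ n) :: complex mat)" "c < dim_col (1\<^sub>m (2 ^ n) :: complex mat)"
  then show "tensor n (\<lambda>_. 1\<^sub>m 2) $$ (r, c) = (1\<^sub>m (2 ^ n) :: complex mat) $$ (r, c)"
    using bits_eq_iff[of r n c] by (auto simp: tensor_index one_mat_of_bool prod_of_bool)
qed (auto simp: tensor_def)

lemma tensor_smult:
  assumes "\<And>q. q < n \<Longrightarrow> U q \<in> carrier_mat 2 2"
  shows "tensor n (\<lambda>q. a q \<cdot>\<^sub>m U q) = (\<Prod>q<n. a q) \<cdot>\<^sub>m tensor n U"
proof (rule eq_matI)
  fix i j assume "i < dim_row ((\<Prod>q<n. a q) \<cdot>\<^sub>m tensor n U)" "j < dim_col ((\<Prod>q<n. a q) \<cdot>\<^sub>m tensor n U)"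
  then have ij: "i < 2 ^ n" "j < 2 ^ n" by (auto simp: tensor_def)
  have "(a q \<cdot>\<^sub>m U q) $$ (of_bool x, of_bool y) = a q * U q $$ (of_bool x, of_bool y)" if "q < n" for q x y
    using assms[OF that] by auto
  then have "tensor n (\<lambda>q. a q \<cdot>\<^sub>m U q) $$ (i, j) =
      (\<Prod>q<n. a q * U q $$ (of_bool (bit i q), of_bool (bit j q)))"
    unfolding tensor_index[OF ij] by (intro prod.cong) auto
  then show "tensor n (\<lambda>q. a q \<cdot>\<^sub>m U q) $$ (i, j) = ((\<Prod>q<n. a q) \<cdot>\<^sub>m tensor n U) $$ (i, j)"
    using ij by (simp add: prod.distrib tensor_index)
qed (auto simp: tensor_def)

lemma tensor_adjoint:
  assumes "\<And>q. q < n \<Longrightarrow> U q \<in> carrier_mat 2 2"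
  shows "mat_adjoint (tensor n U) = tensor n (\<lambda>q. mat_adjoint (U q))"
proof (rule eq_matI)
  fix i j assume "i < dim_row (tensor n (\<lambda>q. mat_adjoint (U q)))" "j < dim_col (tensor n (\<lambda>q. mat_adjoint (U q)))"
  then have ij: "i < 2 ^ n" "j < 2 ^ n" by (auto simp: tensor_def)
  have "cnj (U q $$ (of_bool a, of_bool b)) = mat_adjoint (U q) $$ (of_bool b, of_bool a)" if "q < n" for q a b
    using assms[OF that] by auto
  then have "(\<Prod>q<n. cnj (U q $$ (of_bool (bit j q), of_bool (bit i q)))) =
      (\<Prod>q<n. mat_adjoint (U q) $$ (of_bool (bit i q), of_bool (bit j q)))"
    by (intro prod.cong) auto
  then show "mat_adjoint (tensor n U) $$ (i, j) = tensor n (\<lambda>q. mat_adjoint (U q)) $$ (i, j)"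
    using ij by (simp add: tensor_index)
qed (auto simp: tensor_def)

lemma tensor_unitary:
  assumes "\<And>q. q < n \<Longrightarrow> unitary_mat 2 (U q)"
  shows "unitary_mat (2 ^ n) (tensor n U)"
proof -
  note u = unitary_matD[OF assms]
  have "mat_adjoint (tensor n U) * tensor n U = tensor n (\<lambda>_. 1\<^sub>m 2)"
    "tensor n U * mat_adjoint (tensor n U) = tensor n (\<lambda>_. 1\<^sub>m 2)"
    using u by (simp_all add: tensor_adjoint tensor_mult cong: tensor_cong)
  then show ?thesis by (simp add: unitary_mat_def tensor_one)
qed

text \<open>The identity factors contribute exactly the indicator that row and column agree on all
  qubits other than \<open>q\<close>.\<close>

lemma on_qubit_tensor:
  assumes "q < n"
  shows "on_qubit n q U = tensor n (\<lambda>p. if p = q then U else 1\<^sub>m 2)"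
proof (rule eq_matI)
  fix r c assume "r < dim_row (tensor n (\<lambda>p. if p = q then U else 1\<^sub>m 2))" "c < dim_col (tensor n (\<lambda>p. if p = q then U else 1\<^sub>m 2))"
  then have rc: "r < 2 ^ n" "c < 2 ^ n" by (auto simp: tensor_def)
  have "tensor n (\<lambda>p. if p = q then U else 1\<^sub>m 2) $$ (r, c) =
     U $$ (of_bool (bit r q), of_bool (bit c q)) * (\<Prod>p\<in>{..<n} - {q}. of_bool (bit r p = bit c p))"
    using rc assms by (auto simp: tensor_index prod.remove[of "{..<n}" q] one_mat_of_bool intro!: prod.cong)
  then show "on_qubit n q U $$ (r, c) = tensor n (\<lambda>p. if p = q then U else 1\<^sub>m 2) $$ (r, c)"
    using rc by (auto simp: on_qubit_def prod_of_bool)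
qed (auto simp: tensor_def on_qubit_def)

section \<open>Diagonal operators in the computational basis\<close>

lemma diagm_index: "r < 2 ^ n \<Longrightarrow> c < 2 ^ n \<Longrightarrow> diagm n d $$ (r, c) = (if r = c then d r else 0)"
  by (simp add: diagm_def)

lemma diagm_mult_left_index:
  assumes "M \<in> carrier_mat (2 ^ n) (2 ^ n)" "r < 2 ^ n" "c < 2 ^ n"
  shows "(diagm n d * M) $$ (r, c) = d r * M $$ (r, c)"
proof -
  have "(diagm n d * M) $$ (r, c) = (\<Sum>l<2 ^ n. if l = r then d r * M $$ (r, c) else 0)"
    unfolding mat_mult_index_sum[OF diagm_carrier assms]
    using assms by (intro sum.cong) (auto simp: diagm_index)
  then show ?thesis using assms by simp
qed

lemma diagm_mult_right_index:
  assumes "M \<in> carrier_mat (2 ^ n) (2 ^ n)" "r < 2 ^ n" "c < 2 ^ n"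
  shows "(M * diagm n d) $$ (r, c) = M $$ (r, c) * d c"
proof -
  have "(M * diagm n d) $$ (r, c) = (\<Sum>l<2 ^ n. if l = c then M $$ (r, c) * d c else 0)"
    unfolding mat_mult_index_sum[OF assms(1) diagm_carrier assms(2,3)]
    using assms by (intro sum.cong) (auto simp: diagm_index)
  then show ?thesis using assms by simp
qed

lemma diagm_mult: "diagm n d * diagm n e = diagm n (\<lambda>r. d r * e r)"
proof (rule eq_matI)
  fix i j assume "i < dim_row (diagm n (\<lambda>r. d r * e r))" "j < dim_col (diagm n (\<lambda>r. d r * e r))"
  then show "(diagm n d * diagm n e) $$ (i, j) = diagm n (\<lambda>r. d r * e r) $$ (i, j)"
    by (subst diagm_mult_left_index[OF diagm_carrier]) (auto simp: diagm_def)
qed (auto simp: diagm_def)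

lemma diagm_cong: "(\<And>r. r < 2 ^ n \<Longrightarrow> d r = e r) \<Longrightarrow> diagm n d = diagm n e"
  by (auto simp: diagm_def)

lemma diagm_smult: "c \<cdot>\<^sub>m diagm n d = diagm n (\<lambda>r. c * d r)"
  by (rule eq_matI) (auto simp: diagm_def)

lemma diagm_one: "diagm n (\<lambda>_. 1) = 1\<^sub>m (2 ^ n)"
  by (rule eq_matI) (auto simp: diagm_def)

lemma diagm_adjoint: "mat_adjoint (diagm n d) = diagm n (\<lambda>r. cnj (d r))"
  by (rule eq_matI) (auto simp: diagm_def)

lemma diagm_unitary:
  assumes "\<And>r. r < 2 ^ n \<Longrightarrow> cmod (d r) = 1"
  shows "unitary_mat (2 ^ n) (diagm n d)"
proof -
  have "cnj (d r) * d r = 1" "d r * cnj (d r) = 1" if "r < 2 ^ n" for r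
    using assms[OF that] by (metis complex_norm_square of_real_1 power_one mult.commute)+
  then have "diagm n (\<lambda>r. cnj (d r) * d r) = diagm n (\<lambda>_. 1)" "diagm n (\<lambda>r. d r * cnj (d r)) = diagm n (\<lambda>_. 1)"
    by (auto intro: diagm_cong)
  then show ?thesis by (simp add: unitary_mat_def diagm_adjoint diagm_mult diagm_one)
qed

section \<open>Circuits\<close>

lemma smult_smult_mat: "a \<cdot>\<^sub>m (b \<cdot>\<^sub>m A) = (a * b) \<cdot>\<^sub>m A" for A :: "'a :: semigroup_mult mat"
  by (rule eq_matI) (auto simp: mult.assoc)

lemma gate_mat_carrier: "gate_mat n g \<in> carrier_mat (2 ^ n) (2 ^ n)"
  by (cases g) (auto simp: on_qubit_def cnot_mat_def cz_mat_def zphase_mat_def gms_mat_def mat_exp_def XX_sum_def)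

lemma circuit_mat_carrier: "circuit_mat n gs \<in> carrier_mat (2 ^ n) (2 ^ n)"
  by (induction gs) (auto intro: mult_carrier_mat gate_mat_carrier)

lemma circuit_mat_append: "circuit_mat n (gs @ hs) = circuit_mat n hs * circuit_mat n gs"
  by (induction gs)
    (simp_all add: right_mult_one_mat[OF circuit_mat_carrier]
      assoc_mult_mat[OF circuit_mat_carrier circuit_mat_carrier gate_mat_carrier])

text \<open>The cost predicate of the whole proof. The free phase \<open>c\<close> matches
  implementation up to global phase, and the upper bound makes costs monotone and additive.
  Unitarity is included so that it can be read off directly, without an induction over
  circuits.\<close>

definition gmsable :: "nat \<Rightarrow> nat \<Rightarrow> complex mat \<Rightarrow> bool" where
  "gmsable n k M \<longleftrightarrow> unitary_mat (2 ^ n) M \<and>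
     (\<exists>hs c. untargeted_gms_circuit n hs \<and> gms_count n hs \<le> k \<and> cmod c = 1 \<and> M = c \<cdot>\<^sub>m circuit_mat n hs)"

lemma gmsable_unitary: "gmsable n k M \<Longrightarrow> unitary_mat (2 ^ n) M"
  by (simp add: gmsable_def)

lemma gmsable_mono: "gmsable n k M \<Longrightarrow> k \<le> l \<Longrightarrow> gmsable n l M"
  unfolding gmsable_def using le_trans by blast

lemma gmsable_mult:
  assumes "gmsable n j A" "gmsable n k B"
  shows "gmsable n (j + k) (A * B)"
proof -
  obtain hs c where h: "untargeted_gms_circuit n hs" "gms_count n hs \<le> j" "cmod c = 1" "A = c \<cdot>\<^sub>m circuit_mat n hs"
    using assms(1) by (auto simp: gmsable_def)
  obtain gs d where g: "untargeted_gms_circuit n gs" "gms_count n gs \<le> k" "cmod d = 1" "B = d \<cdot>\<^sub>m circuit_mat n gs"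
    using assms(2) by (auto simp: gmsable_def)
  \<comment> \<open>The right factor acts first, so its circuit is the front of the list.\<close>
  have "A * B = (c * d) \<cdot>\<^sub>m circuit_mat n (gs @ hs)"
    using circuit_mat_carrier[of n hs] circuit_mat_carrier[of n gs]
    by (simp add: h g circuit_mat_append mult_smult_distrib[of _ "2 ^ n" "2 ^ n" _ "2 ^ n"]
        mult_smult_assoc_mat[of _ "2 ^ n" "2 ^ n" _ "2 ^ n"] smult_smult_mat mult.commute)
  moreover have "untargeted_gms_circuit n (gs @ hs)" "gms_count n (gs @ hs) \<le> j + k"
    using g h by (auto simp: untargeted_gms_circuit_def valid_circuit_def gms_count_def)
  moreover have "cmod (c * d) = 1" using g h by (simp add: norm_mult)
  ultimately show ?thesis
    using assms unfolding gmsable_def by (blast intro: unitary_mat_mult)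
qed

lemma gmsable_smult:
  assumes "gmsable n k M" "cmod c = 1"
  shows "gmsable n k (c \<cdot>\<^sub>m M)"
proof -
  obtain hs d where h: "untargeted_gms_circuit n hs" "gms_count n hs \<le> k" "cmod d = 1" "M = d \<cdot>\<^sub>m circuit_mat n hs"
    using assms(1) by (auto simp: gmsable_def)
  have "c \<cdot>\<^sub>m M = (c * d) \<cdot>\<^sub>m circuit_mat n hs" "cmod (c * d) = 1"
    using h assms(2) by (auto simp: smult_smult_mat norm_mult)
  then show ?thesis
    using assms h unfolding gmsable_def by (blast intro: unitary_mat_smult)
qed

text \<open>The tensor product is built one qubit at a time: after \<open>m\<close> gates the qubits
  from \<open>m\<close> on still carry the identity.\<close>

lemma circuit_mat_singles:
  assumes "\<And>q. q < n \<Longrightarrow> U q \<in> carrier_mat 2 2" "m \<le> n"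
  shows "circuit_mat n (map (\<lambda>q. Single q (U q)) [0..<m]) = tensor n (\<lambda>q. if q < m then U q else 1\<^sub>m 2)"
  using assms(2)
proof (induction m)
  case 0
  then show ?case by (simp add: tensor_one)
next
  case (Suc m)
  then have m: "m < n" by simp
  have "circuit_mat n (map (\<lambda>q. Single q (U q)) [0..<Suc m]) =
      on_qubit n m (U m) * tensor n (\<lambda>q. if q < m then U q else 1\<^sub>m 2)"
    using Suc by (simp add: circuit_mat_append left_mult_one_mat[OF on_qubit_carrier])
  also have "\<dots> = tensor n (\<lambda>q. (if q = m then U m else 1\<^sub>m 2) * (if q < m then U q else 1\<^sub>m 2))"
    using m assms(1) unfolding on_qubit_tensor[OF m] by (intro tensor_mult) auto
  also have "\<dots> = tensor n (\<lambda>q. if q < Suc m then U q else 1\<^sub>m 2)"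
  proof (rule tensor_cong)
    fix q assume "q < n"
    then show "(if q = m then U m else 1\<^sub>m 2) * (if q < m then U q else 1\<^sub>m 2) = (if q < Suc m then U q else 1\<^sub>m 2)"
      using assms(1)[of q] by (auto simp: less_Suc_eq)
  qed
  finally show ?case .
qed

lemma gmsable_tensor:
  assumes "\<And>q. q < n \<Longrightarrow> unitary_mat 2 (U q)"
  shows "gmsable n 0 (tensor n U)"
proof -
  let ?hs = "map (\<lambda>q. Single q (U q)) [0..<n]"
  have "circuit_mat n ?hs = tensor n (\<lambda>q. if q < n then U q else 1\<^sub>m 2)"
    by (rule circuit_mat_singles) (use unitary_matD[OF assms] in auto)
  also have "\<dots> = tensor n U" by (rule tensor_cong) auto
  finally have "tensor n U = 1 \<cdot>\<^sub>m circuit_mat n ?hs" by auto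
  moreover have "untargeted_gms_circuit n ?hs"
    using assms by (auto simp: untargeted_gms_circuit_def valid_circuit_def)
  moreover have "gms_count n ?hs \<le> 0" by (simp add: gms_count_def)
  ultimately show ?thesis
    unfolding gmsable_def using tensor_unitary[of n U] assms by (metis norm_one)
qed

lemma gmsable_one: "gmsable n 0 (1\<^sub>m (2 ^ n))"
  using gmsable_tensor[of n "\<lambda>_. 1\<^sub>m 2"] by (simp add: tensor_one unitary_mat_one)

lemma gmsable_on_qubit: "q < n \<Longrightarrow> unitary_mat 2 U \<Longrightarrow> gmsable n 0 (on_qubit n q U)"
  by (auto simp: on_qubit_tensor unitary_mat_one intro: gmsable_tensor)

section \<open>The global gate in diagonal form\<close>

lemma mat2_eqI:
  assumes "A \<in> carrier_mat 2 2" "B \<in> carrier_mat 2 2"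
    "A $$ (0, 0) = B $$ (0, 0)" "A $$ (0, 1) = B $$ (0, 1)"
    "A $$ (1, 0) = B $$ (1, 0)" "A $$ (1, 1) = B $$ (1, 1)"
  shows "A = B"
proof (rule eq_matI)
  fix i j assume "i < dim_row B" "j < dim_col B"
  then have "i = 0 \<or> i = 1" "j = 0 \<or> j = 1" using assms by auto
  then show "A $$ (i, j) = B $$ (i, j)" using assms by auto
qed (use assms in auto)

lemma pauli_X_carrier [simp]: "pauli_X \<in> carrier_mat 2 2"
  and pauli_Z_carrier [simp]: "pauli_Z \<in> carrier_mat 2 2"
  and S_mat_carrier [simp]: "S_mat \<in> carrier_mat 2 2"
  and hadamard_carrier [simp]: "hadamard \<in> carrier_mat 2 2"
  by (auto simp: pauli_X_def pauli_Z_def S_mat_def hadamard_def mat_of_rows_list_def)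

lemma pauli_X_index [simp]:
  "pauli_X $$ (0, 0) = 0" "pauli_X $$ (0, Suc 0) = 1" "pauli_X $$ (Suc 0, 0) = 1" "pauli_X $$ (Suc 0, Suc 0) = 0"
  by (simp_all add: pauli_X_def mat_of_rows_list_def)

lemma pauli_Z_index [simp]:
  "pauli_Z $$ (0, 0) = 1" "pauli_Z $$ (0, Suc 0) = 0" "pauli_Z $$ (Suc 0, 0) = 0" "pauli_Z $$ (Suc 0, Suc 0) = -1"
  by (simp_all add: pauli_Z_def mat_of_rows_list_def)

lemma S_mat_index [simp]:
  "S_mat $$ (0, 0) = 1" "S_mat $$ (0, Suc 0) = 0" "S_mat $$ (Suc 0, 0) = 0" "S_mat $$ (Suc 0, Suc 0) = \<i>"
  by (simp_all add: S_mat_def mat_of_rows_list_def)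

definition inv_sqrt2 :: complex where "inv_sqrt2 = complex_of_real (1 / sqrt 2)"

lemma inv_sqrt2_sq: "inv_sqrt2 * inv_sqrt2 = 1 / 2" "cnj inv_sqrt2 = inv_sqrt2"
  by (simp_all add: inv_sqrt2_def flip: of_real_mult)

lemma hadamard_index [simp]:
  "hadamard $$ (0, 0) = inv_sqrt2" "hadamard $$ (0, Suc 0) = inv_sqrt2" "hadamard $$ (Suc 0, 0) = inv_sqrt2" "hadamard $$ (Suc 0, Suc 0) = - inv_sqrt2"
  by (simp_all add: hadamard_def inv_sqrt2_def mat_of_rows_list_def)

lemma hadamard_dim: "dim_row hadamard = 2" "dim_col hadamard = 2"
  using carrier_matD[OF hadamard_carrier] by simp_all

lemma hadamard_adjoint: "mat_adjoint hadamard = hadamard"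
  by (rule mat2_eqI) (simp_all add: inv_sqrt2_sq mat_adjoint_carrier hadamard_dim)

lemma hadamard_sq: "hadamard * hadamard = 1\<^sub>m 2"
  by (rule mat2_eqI) (auto simp: mat2_mult_index inv_sqrt2_sq mult_carrier_mat[of _ 2 2 _ 2] simp del: index_mult_mat)

lemma hadamard_unitary: "unitary_mat 2 hadamard"
  by (simp add: unitary_mat_def hadamard_adjoint hadamard_sq)

lemma hadamard_Z_hadamard: "hadamard * pauli_Z * hadamard = pauli_X"
  by (rule mat2_eqI) (auto simp: mat2_mult_index mult_carrier_mat[of _ 2 2 _ 2] inv_sqrt2_sq simp del: index_mult_mat)

text \<open>The change to the common eigenbasis of all \<open>X_i\<close>. It is its own inverse and
  needs no global gate.\<close>

definition hadamard_all :: "nat \<Rightarrow> complex mat" where "hadamard_all n = tensor n (\<lambda>_. hadamard)"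

lemma hadamard_all_carrier [simp]: "hadamard_all n \<in> carrier_mat (2 ^ n) (2 ^ n)"
  by (simp add: hadamard_all_def)

lemma hadamard_all_sq: "hadamard_all n * hadamard_all n = 1\<^sub>m (2 ^ n)"
  by (simp add: hadamard_all_def tensor_mult hadamard_sq tensor_one)

lemma gmsable_hadamard_all: "gmsable n 0 (hadamard_all n)"
  by (simp add: hadamard_all_def gmsable_tensor hadamard_unitary)

definition spin :: "nat \<Rightarrow> nat \<Rightarrow> complex" where
  "spin r q = (if bit r q then -1 else 1)"

text \<open>Off the diagonal some bit differs: if it belongs to another qubit the entry vanishes by
  definition, and if it is bit \<open>q\<close> an off-diagonal entry of \<open>U\<close> is
  hit.\<close>

lemma on_qubit_diag:
  assumes q: "q < n" and "U $$ (0, 1) = 0" "U $$ (1, 0) = 0"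
  shows "on_qubit n q U = diagm n (\<lambda>r. U $$ (of_bool (bit r q), of_bool (bit r q)))"
proof (rule eq_matI)
  fix r c assume "r < dim_row (diagm n (\<lambda>r. U $$ (of_bool (bit r q), of_bool (bit r q))))"
    "c < dim_col (diagm n (\<lambda>r. U $$ (of_bool (bit r q), of_bool (bit r q))))"
  then have rc: "r < 2 ^ n" "c < 2 ^ n" by (auto simp: diagm_def)
  show "on_qubit n q U $$ (r, c) = diagm n (\<lambda>r. U $$ (of_bool (bit r q), of_bool (bit r q))) $$ (r, c)"
  proof (cases "r = c")
    case False
    then obtain p where "p < n" "bit r p \<noteq> bit c p" using bits_eq_iff[OF rc] by blast
    then show ?thesis using False rc assms
      by (cases "bit r q"; cases "bit c q") (auto simp: on_qubit_def diagm_index)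
  qed (use rc in \<open>simp add: on_qubit_def diagm_index\<close>)
qed (auto simp: diagm_def on_qubit_def)

lemma on_qubit_Z: "q < n \<Longrightarrow> on_qubit n q pauli_Z = diagm n (\<lambda>r. spin r q)"
  by (subst on_qubit_diag) (auto simp: spin_def intro!: diagm_cong)

lemma on_qubit_X: "q < n \<Longrightarrow> on_qubit n q pauli_X = hadamard_all n * on_qubit n q pauli_Z * hadamard_all n"
  by (auto simp: on_qubit_tensor hadamard_all_def tensor_mult mult_carrier_mat[of _ 2 2 _ 2] hadamard_Z_hadamard
      hadamard_sq right_mult_one_mat[OF hadamard_carrier] intro!: tensor_cong)

lemma conj_diagm_index:
  assumes H: "H \<in> carrier_mat (2 ^ n) (2 ^ n)" and rc: "r < 2 ^ n" "c < 2 ^ n"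
  shows "(H * diagm n d * H) $$ (r, c) = (\<Sum>k<2 ^ n. H $$ (r, k) * d k * H $$ (k, c))"
  unfolding mat_mult_index_sum[OF mult_carrier_mat[OF H diagm_carrier] H rc]
  by (intro sum.cong refl) (simp add: diagm_mult_right_index[OF H rc(1)] del: index_mult_mat)

lemma conj_diagm_mult:
  assumes H: "H \<in> carrier_mat (2 ^ n) (2 ^ n)" "H * H = 1\<^sub>m (2 ^ n)"
  shows "(H * diagm n d * H) * (H * diagm n e * H) = H * diagm n (\<lambda>r. d r * e r) * H"
proof -
  have "(H * diagm n d * H) * (H * diagm n e * H) = (H * diagm n d * H) * (H * (diagm n e * H))"
    using H by (simp add: assoc_mult_mat[of _ "2 ^ n" "2 ^ n" _ "2 ^ n" _ "2 ^ n"] mult_carrier_mat[of _ "2 ^ n" "2 ^ n" _ "2 ^ n"])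
  also have "\<dots> = H * diagm n d * (diagm n e * H)"
    using H by (intro mat_cancel_mid[where d = "2 ^ n"]) (simp_all add: mult_carrier_mat[of _ "2 ^ n" "2 ^ n" _ "2 ^ n"])
  also have "\<dots> = H * (diagm n d * diagm n e) * H"
    using H by (simp add: assoc_mult_mat[of _ "2 ^ n" "2 ^ n" _ "2 ^ n" _ "2 ^ n"] mult_carrier_mat[of _ "2 ^ n" "2 ^ n" _ "2 ^ n"])
  finally show ?thesis by (simp add: diagm_mult)
qed

text \<open>As \<open>H\<close> squares to the identity, the powers of the conjugated matrix are
  conjugates of the powers of the diagonal, so the exponential acts on the diagonal entries
  alone.\<close>

lemma mat_exp_conj_diagm:
  assumes H: "H \<in> carrier_mat (2 ^ n) (2 ^ n)" "H * H = 1\<^sub>m (2 ^ n)"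
  shows "mat_exp (H * diagm n d * H) = H * diagm n (\<lambda>r. exp (d r)) * H"
proof -
  have pow: "(H * diagm n d * H) ^\<^sub>m k = H * diagm n (\<lambda>r. d r ^ k) * H" for k
  proof (induction k)
    case 0
    then show ?case using H by (simp add: diagm_one)
  next
    case (Suc k)
    then show ?case using H by (simp add: conj_diagm_mult mult.commute)
  qed
  show ?thesis
  proof (rule eq_matI)
    fix r c assume "r < dim_row (H * diagm n (\<lambda>r. exp (d r)) * H)" "c < dim_col (H * diagm n (\<lambda>r. exp (d r)) * H)"
    then have rc: "r < 2 ^ n" "c < 2 ^ n" using H by auto
    \<comment> \<open>Each entry is a finite combination of scalar exponential series, so the series
      may be summed term by term.\<close>
    have "(\<lambda>k. \<Sum>m<2 ^ n. H $$ (r, m) * (d m ^ k /\<^sub>R fact k) * H $$ (m, c)) sums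
        (\<Sum>m<2 ^ n. H $$ (r, m) * exp (d m) * H $$ (m, c))"
      by (intro sums_sum sums_mult sums_mult2 exp_converges)
    moreover have "(\<Sum>m<2 ^ n. H $$ (r, m) * (d m ^ k /\<^sub>R fact k) * H $$ (m, c)) =
       ((H * diagm n d * H) ^\<^sub>m k) $$ (r, c) / fact k" for k
      unfolding pow conj_diagm_index[OF H(1) rc]
      by (simp add: sum_distrib_left scaleR_conv_of_real divide_inverse mult_ac)
    ultimately have "(\<lambda>k. ((H * diagm n d * H) ^\<^sub>m k) $$ (r, c) / fact k) sums
      (\<Sum>m<2 ^ n. H $$ (r, m) * exp (d m) * H $$ (m, c))" by simp
    then show "mat_exp (H * diagm n d * H) $$ (r, c) = (H * diagm n (\<lambda>r. exp (d r)) * H) $$ (r, c)"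
      using rc H unfolding conj_diagm_index[OF H(1) rc] mat_exp_def by (simp add: sums_iff)
  qed (use H in \<open>auto simp: mat_exp_def\<close>)
qed

lemma zphase_mat_eq:
  assumes "q < n"
  shows "zphase_mat n q \<alpha> = diagm n (\<lambda>r. exp (- \<i> * complex_of_real (\<alpha> / 2) * spin r q))"
proof -
  have "1\<^sub>m (2 ^ n) * diagm n d * 1\<^sub>m (2 ^ n) = diagm n d" for d
    by (simp add: left_mult_one_mat[OF diagm_carrier] right_mult_one_mat[OF diagm_carrier])
  then show ?thesis
    using mat_exp_conj_diagm[OF one_carrier_mat, of n "\<lambda>r. - \<i> * complex_of_real (\<alpha> / 2) * spin r q"] assms
    by (simp add: zphase_mat_def on_qubit_Z diagm_smult del: of_real_divide)
qed

text \<open>Squaring the total spin gives all ordered pairs; the \<open>n\<close> diagonal pairs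
  contribute 1 each because a spin squares to 1.\<close>

lemma sum_spin_pairs:
  "(\<Sum>(i, j)\<in>{(i, j). i \<in> {..<n} \<and> j \<in> {..<n} \<and> i \<noteq> j}. spin r i * spin r j) = (\<Sum>i<n. spin r i)\<^sup>2 - of_nat n"
proof -
  have "(\<Sum>i<n. spin r i)\<^sup>2 = (\<Sum>(i, j)\<in>{..<n} \<times> {..<n}. spin r i * spin r j)"
    by (simp add: power2_eq_square sum_product sum.cartesian_product)
  also have "{..<n} \<times> {..<n} = {(i, j). i \<in> {..<n} \<and> j \<in> {..<n} \<and> i \<noteq> j} \<union> (\<lambda>i. (i, i)) ` {..<n}"
    by auto
  also have "(\<Sum>(i, j)\<in>\<dots>. spin r i * spin r j) =
     (\<Sum>(i, j)\<in>{(i, j). i \<in> {..<n} \<and> j \<in> {..<n} \<and> i \<noteq> j}. spin r i * spin r j) + (\<Sum>i<n. spin r i * spin r i)"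
    by (subst sum.union_disjoint)
      (auto simp: sum.reindex inj_on_def intro: finite_subset[of _ "{..<n} \<times> {..<n}"])
  finally show ?thesis by (simp add: spin_def if_distrib cong: if_cong)
qed

text \<open>The Hadamard layer diagonalises all \<open>X_i X_j\<close> simultaneously with
  eigenvalues \<open>spin r i * spin r j\<close>; after exchanging the sums, the pair sum is
  evaluated on each basis state.\<close>

lemma XX_sum_eq: "XX_sum n {..<n} = hadamard_all n * diagm n (\<lambda>r. (\<Sum>i<n. spin r i)\<^sup>2 - of_nat n) * hadamard_all n"
proof (rule eq_matI)
  fix r c assume "r < dim_row (hadamard_all n * diagm n (\<lambda>r. (\<Sum>i<n. spin r i)\<^sup>2 - of_nat n) * hadamard_all n)"
    "c < dim_col (hadamard_all n * diagm n (\<lambda>r. (\<Sum>i<n. spin r i)\<^sup>2 - of_nat n) * hadamard_all n)"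
  then have rc: "r < 2 ^ n" "c < 2 ^ n" using carrier_matD[OF hadamard_all_carrier[of n]] by auto
  let ?A = "{(i, j). i \<in> {..<n} \<and> j \<in> {..<n} \<and> i \<noteq> j}"
  have XX: "(on_qubit n i pauli_X * on_qubit n j pauli_X) $$ (r, c) =
     (\<Sum>k<2 ^ n. hadamard_all n $$ (r, k) * (spin k i * spin k j) * hadamard_all n $$ (k, c))" if "i < n" "j < n" for i j
    unfolding on_qubit_X[OF that(1)] on_qubit_X[OF that(2)] on_qubit_Z[OF that(1)] on_qubit_Z[OF that(2)]
      conj_diagm_mult[OF hadamard_all_carrier hadamard_all_sq] conj_diagm_index[OF hadamard_all_carrier rc] ..
  have "XX_sum n {..<n} $$ (r, c) = (\<Sum>(i, j)\<in>?A. \<Sum>k<2 ^ n. hadamard_all n $$ (r, k) * (spin k i * spin k j) * hadamard_all n $$ (k, c))"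
    using rc unfolding XX_sum_def by (auto simp: XX simp del: index_mult_mat intro!: sum.cong)
  also have "\<dots> = (\<Sum>k<2 ^ n. \<Sum>(i, j)\<in>?A. hadamard_all n $$ (r, k) * (spin k i * spin k j) * hadamard_all n $$ (k, c))"
    unfolding split_def by (rule sum.swap)
  also have "\<dots> = (\<Sum>k<2 ^ n. hadamard_all n $$ (r, k) * ((\<Sum>i<n. spin k i)\<^sup>2 - of_nat n) * hadamard_all n $$ (k, c))"
    unfolding sum_spin_pairs[symmetric] by (simp add: split_def sum_distrib_left sum_distrib_right)
  finally show "XX_sum n {..<n} $$ (r, c) = (hadamard_all n * diagm n (\<lambda>r. (\<Sum>i<n. spin r i)\<^sup>2 - of_nat n) * hadamard_all n) $$ (r, c)"
    unfolding conj_diagm_index[OF hadamard_all_carrier rc] .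
qed (use carrier_matD[OF hadamard_all_carrier[of n]] in \<open>auto simp: XX_sum_def\<close>)

definition spin_gate :: "nat \<Rightarrow> real \<Rightarrow> complex mat" where
  "spin_gate n \<alpha> = diagm n (\<lambda>r. exp (- \<i> * complex_of_real (\<alpha> / 4) * ((\<Sum>i<n. spin r i)\<^sup>2 - of_nat n)))"

lemma gms_mat_eq: "gms_mat n {..<n} \<alpha> = hadamard_all n * spin_gate n \<alpha> * hadamard_all n"
proof -
  let ?d = "\<lambda>r. (\<Sum>i<n. spin r i)\<^sup>2 - of_nat n" and ?a = "- \<i> * complex_of_real (\<alpha> / 4)"
  have "?a \<cdot>\<^sub>m (hadamard_all n * diagm n ?d * hadamard_all n) = hadamard_all n * (?a \<cdot>\<^sub>m diagm n ?d) * hadamard_all n"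
    by (simp add: mult_smult_distrib[of _ "2 ^ n" "2 ^ n" _ "2 ^ n"] mult_carrier_mat[of _ "2 ^ n" "2 ^ n" _ "2 ^ n"]
        mult_smult_assoc_mat[of _ "2 ^ n" "2 ^ n" _ "2 ^ n"] del: of_real_divide)
  then show ?thesis
    by (simp add: gms_mat_def XX_sum_eq diagm_smult mat_exp_conj_diagm hadamard_all_sq spin_gate_def del: of_real_divide)
qed

lemma spin_real: "spin r i = complex_of_real (if bit r i then -1 else 1)"
  by (simp add: spin_def)

lemma spin_gate_unitary: "unitary_mat (2 ^ n) (spin_gate n \<alpha>)"
  unfolding spin_gate_def
proof (rule diagm_unitary)
  fix r
  \<comment> \<open>Spins are real, so the exponent is purely imaginary and the entry has modulus
    1.\<close>
  have "- \<i> * complex_of_real (\<alpha> / 4) * ((\<Sum>i<n. spin r i)\<^sup>2 - of_nat n) =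
    \<i> * complex_of_real (- (\<alpha> / 4) * ((\<Sum>i<n. if bit r i then -1 else 1)\<^sup>2 - real n))"
    by (simp add: spin_real)
  then show "cmod (exp (- \<i> * complex_of_real (\<alpha> / 4) * ((\<Sum>i<n. spin r i)\<^sup>2 - of_nat n))) = 1"
    by (simp only: norm_exp_i_times)
qed

text \<open>Hadamard layers on both sides of the global gate undo the conjugation in
  \<open>gms_mat_eq\<close> for free. From here on the global gate is used only in this diagonal
  form.\<close>

lemma gmsable_spin_gate: "gmsable n 1 (spin_gate n \<alpha>)"
proof -
  have T: "spin_gate n \<alpha> \<in> carrier_mat (2 ^ n) (2 ^ n)" by (simp add: spin_gate_def)
  have un: "unitary_mat (2 ^ n) (gms_mat n {..<n} \<alpha>)"
    unfolding gms_mat_eq using gmsable_unitary[OF gmsable_hadamard_all[of n]] spin_gate_unitary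
    by (intro unitary_mat_mult)
  have "gmsable n 1 (gms_mat n {..<n} \<alpha>)"
    unfolding gmsable_def
  proof (intro conjI un exI[of _ "[GMS {..<n} \<alpha>]"] exI[of _ 1])
    show "gms_mat n {..<n} \<alpha> = 1 \<cdot>\<^sub>m circuit_mat n [GMS {..<n} \<alpha>]"
      using unitary_matD(1)[OF un] by auto
  qed (simp_all add: untargeted_gms_circuit_def valid_circuit_def gms_count_def)
  then have "gmsable n (0 + (1 + 0)) (hadamard_all n * (gms_mat n {..<n} \<alpha> * hadamard_all n))"
    by (intro gmsable_mult gmsable_hadamard_all)
  also have "hadamard_all n * (gms_mat n {..<n} \<alpha> * hadamard_all n) = (hadamard_all n * hadamard_all n) * spin_gate n \<alpha> * (hadamard_all n * hadamard_all n)"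
    unfolding gms_mat_eq using T
    by (simp add: assoc_mult_mat[of _ "2 ^ n" "2 ^ n" _ "2 ^ n" _ "2 ^ n"] mult_carrier_mat[of _ "2 ^ n" "2 ^ n" _ "2 ^ n"])
  also have "\<dots> = spin_gate n \<alpha>" using T by (simp add: hadamard_all_sq)
  finally show ?thesis by simp
qed

section \<open>Pauli operators\<close>

lemma one_smult_mat [simp]: "1 \<cdot>\<^sub>m A = A" for A :: "'a :: monoid_mult mat"
  by (rule eq_matI) auto

lemma smult_mult_smult:
  fixes A B :: "complex mat"
  assumes "A \<in> carrier_mat d d" "B \<in> carrier_mat d d"
  shows "(a \<cdot>\<^sub>m A) * (b \<cdot>\<^sub>m B) = (a * b) \<cdot>\<^sub>m (A * B)"
  using assms
  by (simp add: mult_smult_distrib[of _ d d _ d] mult_smult_assoc_mat[of _ d d _ d] smult_smult_mat mult.commute)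

text \<open>\<open>pauli1 a b\<close> is \<open>X\<^sup>a Z\<^sup>b\<close>.\<close>

definition pauli1 :: "bool \<Rightarrow> bool \<Rightarrow> complex mat" where
  "pauli1 a b = mat 2 2 (\<lambda>(i, j). if (i \<noteq> j) = a then (if b \<and> j = 1 then -1 else 1) else 0)"

definition pauli :: "nat \<Rightarrow> (nat \<Rightarrow> bool) \<Rightarrow> (nat \<Rightarrow> bool) \<Rightarrow> complex mat" where
  "pauli n a b = tensor n (\<lambda>q. pauli1 (a q) (b q))"

text \<open>The scalar is arbitrary, even 0, so the set is closed under products and scalar
  multiples and phases need not be tracked. Where the phase matters, \<open>pauli_inv\<close> is
  used.\<close>

definition paulis :: "nat \<Rightarrow> complex mat set" where
  "paulis n = {c \<cdot>\<^sub>m pauli n a b | c a b. True}"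

lemma pauli1_carrier [simp]: "pauli1 a b \<in> carrier_mat 2 2"
  by (simp add: pauli1_def)

lemma pauli1_dim [simp]: "dim_row (pauli1 a b) = 2" "dim_col (pauli1 a b) = 2"
  by (simp_all add: pauli1_def)

lemma pauli1_index:
  "pauli1 a b $$ (of_bool x, of_bool y) = (if (x \<noteq> y) = a then if b \<and> y then -1 else 1 else 0)"
  by (cases x; cases y; simp add: pauli1_def)

lemma pauli1_index' [simp]:
  "pauli1 a b $$ (0, 0) = (if a then 0 else 1)" "pauli1 a b $$ (0, Suc 0) = (if a then if b then -1 else 1 else 0)"
  "pauli1 a b $$ (Suc 0, 0) = (if a then 1 else 0)" "pauli1 a b $$ (Suc 0, Suc 0) = (if a then 0 else if b then -1 else 1)"
  by (simp_all add: pauli1_def)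

text \<open>The sign comes from moving \<open>Z\<close> past \<open>X\<close> to restore the normal
  order.\<close>

lemma pauli1_mult: "pauli1 a b * pauli1 a' b' = (if b \<and> a' then -1 else 1) \<cdot>\<^sub>m pauli1 (a \<noteq> a') (b \<noteq> b')"
  by (rule mat2_eqI) (auto simp: mat2_mult_index mult_carrier_mat[of _ 2 2 _ 2] simp del: index_mult_mat)

lemma pauli1_adjoint: "mat_adjoint (pauli1 a b) = (if a \<and> b then -1 else 1) \<cdot>\<^sub>m pauli1 a b"
  by (rule mat2_eqI) (auto simp: mat_adjoint_carrier)

lemma pauli1_one: "pauli1 False False = 1\<^sub>m 2"
  by (rule mat2_eqI) auto

lemma pauli1_unitary: "unitary_mat 2 (pauli1 a b)"
  unfolding unitary_mat_def pauli1_adjoint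
  by (auto simp: mult_smult_distrib[of _ 2 2 _ 2] mult_smult_assoc_mat[of _ 2 2 _ 2] pauli1_mult pauli1_one smult_smult_mat
      intro!: eq_matI)

lemma pauli_carrier [simp]: "pauli n a b \<in> carrier_mat (2 ^ n) (2 ^ n)"
  by (simp add: pauli_def)

lemma pauli_dim [simp]: "dim_row (pauli n a b) = 2 ^ n" "dim_col (pauli n a b) = 2 ^ n"
  by (simp_all add: pauli_def)

lemma pauli_cong: "(\<And>q. q < n \<Longrightarrow> a q = a' q) \<Longrightarrow> (\<And>q. q < n \<Longrightarrow> b q = b' q) \<Longrightarrow> pauli n a b = pauli n a' b'"
  unfolding pauli_def by (rule tensor_cong) simp

lemma prod_if_zero:
  "finite A \<Longrightarrow> (\<Prod>q\<in>A. if P q then f q else 0) = (if \<forall>q\<in>A. P q then \<Prod>q\<in>A. f q else (0 :: 'a :: comm_semiring_1))"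
  by (induction A rule: finite_induct) auto

lemma pauli_index:
  assumes "r < 2 ^ n" "c < 2 ^ n"
  shows "pauli n a b $$ (r, c) =
    (if \<forall>q<n. (bit r q \<noteq> bit c q) = a q then \<Prod>q<n. if b q \<and> bit c q then -1 else 1 else 0)"
  using assms unfolding pauli_def tensor_index[OF assms] pauli1_index by (subst prod_if_zero) auto

lemma pauli_unitary: "unitary_mat (2 ^ n) (pauli n a b)"
  unfolding pauli_def by (rule tensor_unitary[OF pauli1_unitary])

lemma gmsable_pauli: "gmsable n 0 (pauli n a b)"
  unfolding pauli_def by (rule gmsable_tensor[OF pauli1_unitary])

lemma pauli_one: "pauli n (\<lambda>_. False) (\<lambda>_. False) = 1\<^sub>m (2 ^ n)"
  by (simp add: pauli_def pauli1_one tensor_one)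

lemma pauli_mult:
  "pauli n a b * pauli n a' b' = (\<Prod>q<n. if b q \<and> a' q then -1 else 1) \<cdot>\<^sub>m pauli n (\<lambda>q. a q \<noteq> a' q) (\<lambda>q. b q \<noteq> b' q)"
  unfolding pauli_def by (subst tensor_mult) (simp_all add: pauli1_mult tensor_smult)

lemma pauli_in_paulis [simp]: "pauli n a b \<in> paulis n"
proof -
  have "pauli n a b = 1 \<cdot>\<^sub>m pauli n a b" by auto
  then show ?thesis unfolding paulis_def by blast
qed

lemma paulisE:
  assumes "P \<in> paulis n"
  obtains c a b where "P = c \<cdot>\<^sub>m pauli n a b"
  using assms unfolding paulis_def by blast

lemma smult_in_paulis: "P \<in> paulis n \<Longrightarrow> c \<cdot>\<^sub>m P \<in> paulis n"
  by (erule paulisE) (auto simp: smult_smult_mat paulis_def)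

lemma paulis_carrier: "P \<in> paulis n \<Longrightarrow> P \<in> carrier_mat (2 ^ n) (2 ^ n)"
  unfolding paulis_def by auto

lemma paulis_mult: "P \<in> paulis n \<Longrightarrow> Q \<in> paulis n \<Longrightarrow> P * Q \<in> paulis n"
  by (elim paulisE)
    (simp add: smult_mult_smult[OF pauli_carrier pauli_carrier] pauli_mult smult_in_paulis)

text \<open>Both orders of multiplication give multiples of the same operator \<open>?R\<close>; the
  two prefactors differ only by products of signs.\<close>

lemma paulis_commute:
  assumes "P \<in> paulis n" "Q \<in> paulis n"
  shows "Q * P = P * Q \<or> Q * P = - 1 \<cdot>\<^sub>m (P * Q)"
proof -
  have sq: "(\<Prod>q<n. if R q then -1 else 1 :: complex) = 1 \<or> (\<Prod>q<n. if R q then -1 else 1 :: complex) = -1" for R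
    by (induction n) auto
  obtain c a b where P: "P = c \<cdot>\<^sub>m pauli n a b" using assms(1) by (rule paulisE)
  obtain d a' b' where Q: "Q = d \<cdot>\<^sub>m pauli n a' b'" using assms(2) by (rule paulisE)
  let ?R = "pauli n (\<lambda>q. a q \<noteq> a' q) (\<lambda>q. b q \<noteq> b' q)"
  let ?e = "\<Prod>q<n. if b q \<and> a' q then -1 else 1 :: complex" and ?f = "\<Prod>q<n. if b' q \<and> a q then -1 else 1 :: complex"
  have R: "pauli n (\<lambda>q. a' q \<noteq> a q) (\<lambda>q. b' q \<noteq> b q) = ?R"
    by (rule pauli_cong) auto
  have PQ: "P * Q = (c * d * ?e) \<cdot>\<^sub>m ?R" "Q * P = (c * d * ?f) \<cdot>\<^sub>m ?R"
    unfolding P Q smult_mult_smult[OF pauli_carrier pauli_carrier] pauli_mult smult_smult_mat R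
    by (simp_all only: mult_ac)
  show ?thesis
    using sq[of "\<lambda>q. b q \<and> a' q"] sq[of "\<lambda>q. b' q \<and> a q"] unfolding PQ smult_smult_mat
    by (elim disjE) simp_all
qed

text \<open>The entries of a Pauli operator live where row and column differ exactly on its X-part
  \<open>a\<close>; moving a diagonal through it therefore relabels the diagonal by flipping these
  bits.\<close>

lemma pauli_diagm_commute:
  assumes "\<And>r c. r < 2 ^ n \<Longrightarrow> c < 2 ^ n \<Longrightarrow> (\<And>q. q < n \<Longrightarrow> (bit r q \<noteq> bit c q) = a q) \<Longrightarrow> d' r = d c"
  shows "pauli n a b * diagm n d = diagm n d' * pauli n a b"
proof (rule eq_matI)
  fix r c assume "r < dim_row (diagm n d' * pauli n a b)" "c < dim_col (diagm n d' * pauli n a b)"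
  then have rc: "r < 2 ^ n" "c < 2 ^ n" by (auto simp: diagm_def)
  then show "(pauli n a b * diagm n d) $$ (r, c) = (diagm n d' * pauli n a b) $$ (r, c)"
    using assms[of r c] unfolding diagm_mult_left_index[OF pauli_carrier rc] diagm_mult_right_index[OF pauli_carrier rc]
    by (auto simp: pauli_index)
qed (auto simp: diagm_def)

lemma pauli_Z_type: "pauli n (\<lambda>_. False) b = diagm n (\<lambda>c. \<Prod>q<n. if b q \<and> bit c q then -1 else 1)"
proof (rule eq_matI)
  fix r c assume "r < dim_row (diagm n (\<lambda>c. \<Prod>q<n. if b q \<and> bit c q then -1 else 1))"
    "c < dim_col (diagm n (\<lambda>c. \<Prod>q<n. if b q \<and> bit c q then -1 else 1))"
  then have rc: "r < 2 ^ n" "c < 2 ^ n" by (auto simp: diagm_def)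
  then show "pauli n (\<lambda>_. False) b $$ (r, c) = diagm n (\<lambda>c. \<Prod>q<n. if b q \<and> bit c q then -1 else 1) $$ (r, c)"
    using bits_eq_iff[OF rc] by (auto simp: pauli_index diagm_index)
qed (auto simp: diagm_def)

section \<open>A bipartite controlled-Z layer from two global gates\<close>

text \<open>The controlled-Z gates between all pairs in \<open>({..<n} - B) \<times> B\<close>.\<close>

definition cz_layer :: "nat \<Rightarrow> nat set \<Rightarrow> complex mat" where
  "cz_layer n B = diagm n (\<lambda>r. (-1) ^ (card {q \<in> {..<n} - B. bit r q} * card {q \<in> B. bit r q}))"

lemma sum_spin:
  assumes "finite A"
  shows "(\<Sum>i\<in>A. spin r i) = of_nat (card A) - 2 * of_nat (card {i \<in> A. bit r i})"
  using assms
proof (induction A rule: finite_induct)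
  case (insert i A)
  then have "{j \<in> insert i A. bit r j} = (if bit r i then insert i {j \<in> A. bit r j} else {j \<in> A. bit r j})" by auto
  then show ?case using insert by (simp add: spin_def)
qed simp

text \<open>With \<open>a\<close>, \<open>b\<close> qubits on the two sides and \<open>x\<close>,
  \<open>y\<close> of them set, the partial spin sums are \<open>a - 2 x\<close> and
  \<open>b - 2 y\<close>. Expanding their product, the first factor cancels the constant term and
  the second the linear terms. What remains is \<open>exp (- \<i> * pi * x * y)\<close>, a sign. The
  linear terms are one-qubit phases.\<close>

lemma cz_layer_phase:
  fixes a b x y :: nat
  shows "(-1) ^ (x * y) = exp (\<i> * (pi / 4) * (of_nat a * of_nat b)) *
     exp (- \<i> * (pi / 2) * (of_nat b * of_nat x + of_nat a * of_nat y)) *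
     exp (- \<i> * (pi / 4) * ((of_nat a - 2 * of_nat x) * (of_nat b - 2 * of_nat y)))"
proof -
  have "(- 1) ^ (x * y) = exp (of_nat (x * y) * (- \<i> * pi))"
    unfolding exp_of_nat_mult by (simp add: exp_minus)
  also have "of_nat (x * y) * (- \<i> * pi) = \<i> * (pi / 4) * (of_nat a * of_nat b) +
     - \<i> * (pi / 2) * (of_nat b * of_nat x + of_nat a * of_nat y) +
     - \<i> * (pi / 4) * ((of_nat a - 2 * of_nat x) * (of_nat b - 2 * of_nat y))"
    by (simp add: algebra_simps)
  finally show ?thesis
    unfolding exp_add .
qed

definition phase2 :: "complex \<Rightarrow> complex mat" where
  "phase2 w = mat 2 2 (\<lambda>(i, j). if i = j then if i = 0 then 1 else exp w else 0)"

lemma phase2_unitary: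
  assumes "Re w = 0"
  shows "unitary_mat 2 (phase2 w)"
proof -
  have "cmod (exp w) = 1" using assms by simp
  then have "exp w * cnj (exp w) = 1" by (metis complex_norm_square of_real_1 power_one)
  moreover from this have "cnj (exp w) * exp w = 1" by (simp only: mult.commute)
  moreover have P: "phase2 w \<in> carrier_mat 2 2" by (simp add: phase2_def)
  ultimately show ?thesis
    unfolding unitary_mat_def
    by (intro conjI mat2_eqI)
      (auto simp: mat2_mult_index mult_carrier_mat[of _ 2 2 _ 2] mat_adjoint_carrier phase2_def simp del: index_mult_mat)
qed

lemma tensor_phase2: "tensor n (\<lambda>q. phase2 (w q)) = diagm n (\<lambda>r. exp (\<Sum>q<n. if bit r q then w q else 0))"
proof (rule eq_matI)
  fix r c assume "r < dim_row (diagm n (\<lambda>r. exp (\<Sum>q<n. if bit r q then w q else 0)))"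
    "c < dim_col (diagm n (\<lambda>r. exp (\<Sum>q<n. if bit r q then w q else 0)))"
  then have rc: "r < 2 ^ n" "c < 2 ^ n" by (auto simp: diagm_def)
  have "phase2 w $$ (of_bool x, of_bool y) = (if x = y then exp (if y then w else 0) else 0)" for w x y
    by (cases x; cases y) (auto simp: phase2_def)
  then have "tensor n (\<lambda>q. phase2 (w q)) $$ (r, c) =
     (\<Prod>q<n. if bit r q = bit c q then exp (if bit c q then w q else 0) else 0)"
    using rc by (simp add: tensor_index)
  also have "\<dots> = (if \<forall>q<n. bit r q = bit c q then \<Prod>q<n. exp (if bit c q then w q else 0) else 0)"
    by (subst prod_if_zero) auto
  finally show "tensor n (\<lambda>q. phase2 (w q)) $$ (r, c) = diagm n (\<lambda>r. exp (\<Sum>q<n. if bit r q then w q else 0)) $$ (r, c)"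
    using rc by (simp add: bits_eq_iff[OF rc] diagm_index exp_sum)
qed (auto simp: diagm_def)

lemma gmsable_cz_layer:
  assumes B: "B \<subseteq> {..<n}"
  shows "gmsable n 2 (cz_layer n B)"
proof -
  define A where "A = {..<n} - B"
  have fin: "finite A" "finite B" using B finite_subset by (auto simp: A_def)
  have un: "{..<n} = A \<union> B" "A \<inter> B = {}" using B by (auto simp: A_def)
  let ?a = "\<lambda>r. \<Sum>i\<in>A. spin r i" and ?b = "\<lambda>r. \<Sum>i\<in>B. spin r i"
  have ab: "(\<Sum>i<n. spin r i) = ?a r + ?b r" for r
    unfolding un(1) using fin un(2) by (simp add: sum.union_disjoint)
  \<comment> \<open>Flips exactly the qubits of \<open>B\<close>, which negates the partial sum
    \<open>?b\<close> and keeps \<open>?a\<close>.\<close>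
  let ?X = "pauli n (\<lambda>q. q \<in> B) (\<lambda>_. False)"
  let ?T' = "diagm n (\<lambda>r. exp (\<i> * (pi / 16) * ((?a r - ?b r)\<^sup>2 - of_nat n)))"
  have XX: "?X * ?X = 1\<^sub>m (2 ^ n)"
    by (simp add: pauli_mult pauli_one)
  have "?X * spin_gate n (- (pi / 4)) = ?T' * ?X"
    unfolding spin_gate_def
  proof (rule pauli_diagm_commute)
    fix r c assume "r < (2 ^ n :: nat)" "c < (2 ^ n :: nat)" and q: "\<And>q. q < n \<Longrightarrow> (bit r q \<noteq> bit c q) = (q \<in> B)"
    have "?a c = ?a r"
      using un q by (intro sum.cong refl) (auto simp: spin_def)
    moreover have "?b c = - ?b r"
      unfolding sum_negf[symmetric] using un q B by (intro sum.cong refl) (auto simp: spin_def subset_iff)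
    ultimately show "exp (\<i> * (pi / 16) * ((?a r - ?b r)\<^sup>2 - of_nat n)) =
       exp (- \<i> * complex_of_real (- (pi / 4) / 4) * ((\<Sum>i<n. spin c i)\<^sup>2 - of_nat n))"
      unfolding ab by simp
  qed
  then have "?X * spin_gate n (- (pi / 4)) * ?X = ?T'"
    using XX by (simp add: assoc_mult_mat[of _ "2 ^ n" "2 ^ n" _ "2 ^ n" _ "2 ^ n"] right_mult_one_mat[OF diagm_carrier])
  moreover have "gmsable n (0 + 1 + 0) (?X * spin_gate n (- (pi / 4)) * ?X)"
    by (intro gmsable_mult gmsable_pauli gmsable_spin_gate)
  ultimately have "gmsable n 1 ?T'" by simp
  then have "gmsable n (1 + 1) (spin_gate n (pi / 4) * ?T')"
    by (intro gmsable_mult gmsable_spin_gate)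
  \<comment> \<open>With opposite angles the squares and the offset \<open>m\<close>, instantiated
    to \<open>n\<close>, cancel, leaving \<open>4 u v\<close> with coefficient
    \<open>pi / 16\<close>.\<close>
  have phase: "- \<i> * complex_of_real (pi / 4 / 4) * ((u + v)\<^sup>2 - m) + \<i> * (pi / 16) * ((u - v)\<^sup>2 - m) =
      - \<i> * (pi / 4) * (u * v)" for u v m :: complex
    by (simp add: power2_eq_square algebra_simps add_divide_distrib)
  note \<open>gmsable n (1 + 1) (spin_gate n (pi / 4) * ?T')\<close>
  also have "spin_gate n (pi / 4) * ?T' = diagm n (\<lambda>r. exp (- \<i> * (pi / 4) * (?a r * ?b r)))"
    unfolding spin_gate_def diagm_mult exp_add[symmetric] ab
    by (rule diagm_cong, rule arg_cong[where f = exp], rule phase)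
  finally have g2: "gmsable n 2 (diagm n (\<lambda>r. exp (- \<i> * (pi / 4) * (?a r * ?b r))))"
    unfolding one_add_one .
  \<comment> \<open>The linear terms of \<open>cz_layer_phase\<close> distributed over qubits: each
    set bit contributes a phase proportional to the number of qubits on the opposite side.\<close>
  let ?w = "\<lambda>q. - \<i> * (pi / 2) * (if q \<in> B then of_nat (card A) else of_nat (card B))"
  have "gmsable n 0 (tensor n (\<lambda>q. phase2 (?w q)))"
    by (intro gmsable_tensor phase2_unitary) auto
  from gmsable_mult[OF this g2] have "gmsable n 2 (diagm n (\<lambda>r. exp (\<Sum>q<n. if bit r q then ?w q else 0) *
      exp (- \<i> * (pi / 4) * (?a r * ?b r))))"
    unfolding tensor_phase2 diagm_mult add_0_left .
  then have "gmsable n 2 (exp (\<i> * (pi / 4) * (of_nat (card A) * of_nat (card B))) \<cdot>\<^sub>m diagm n (\<lambda>r. exp (\<Sum>q<n. if bit r q then ?w q else 0) *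
      exp (- \<i> * (pi / 4) * (?a r * ?b r))))"
    by (rule gmsable_smult) simp
  also have "exp (\<i> * (pi / 4) * (of_nat (card A) * of_nat (card B))) \<cdot>\<^sub>m diagm n (\<lambda>r. exp (\<Sum>q<n. if bit r q then ?w q else 0) *
      exp (- \<i> * (pi / 4) * (?a r * ?b r))) = cz_layer n B"
    unfolding diagm_smult cz_layer_def A_def[symmetric]
  proof (rule diagm_cong)
    fix r :: nat
    have "(\<Sum>q<n. if bit r q then ?w q else 0) = (\<Sum>q\<in>A. if bit r q then ?w q else 0) + (\<Sum>q\<in>B. if bit r q then ?w q else 0)"
      unfolding un(1) using fin un(2) by (simp add: sum.union_disjoint)
    also have "(\<Sum>q\<in>A. if bit r q then ?w q else 0) = (\<Sum>q\<in>{q \<in> A. bit r q}. - \<i> * (pi / 2) * of_nat (card B))"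
      using un fin by (intro sum.mono_neutral_cong_right) auto
    also have "(\<Sum>q\<in>B. if bit r q then ?w q else 0) = (\<Sum>q\<in>{q \<in> B. bit r q}. - \<i> * (pi / 2) * of_nat (card A))"
      using un fin by (intro sum.mono_neutral_cong_right) auto
    finally have w: "(\<Sum>q<n. if bit r q then ?w q else 0) = - \<i> * (pi / 2) *
       (of_nat (card B) * of_nat (card {q \<in> A. bit r q}) + of_nat (card A) * of_nat (card {q \<in> B. bit r q}))"
      by (simp add: algebra_simps)
    show "exp (\<i> * (pi / 4) * (of_nat (card A) * of_nat (card B))) * (exp (\<Sum>q<n. if bit r q then ?w q else 0) *
      exp (- \<i> * (pi / 4) * (?a r * ?b r))) = (- 1) ^ (card {q \<in> A. bit r q} * card {q \<in> B. bit r q})"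
      unfolding w sum_spin[OF fin(1)] sum_spin[OF fin(2)]
      by (subst cz_layer_phase[where a = "card A" and b = "card B"]) (simp only: mult.assoc)
  qed
  finally show ?thesis .
qed

section \<open>Clifford operators\<close>

text \<open>With this orientation \<open>P * C = C * conj_by C P\<close>, so an operator passes a
  Clifford operator from its left to its right. Composition is reversed: \<open>A * B\<close>
  conjugates by \<open>A\<close> first.\<close>

definition conj_by :: "complex mat \<Rightarrow> complex mat \<Rightarrow> complex mat" where
  "conj_by C P = mat_adjoint C * P * C"

lemma conj_by_carrier: "C \<in> carrier_mat d d \<Longrightarrow> P \<in> carrier_mat d d \<Longrightarrow> conj_by C P \<in> carrier_mat d d"
  unfolding conj_by_def by (intro mult_carrier_mat[of _ d d _ d] mat_adjoint_carrier)

lemma conj_by_mult: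
  assumes "unitary_mat d C" "P \<in> carrier_mat d d" "Q \<in> carrier_mat d d"
  shows "conj_by C (P * Q) = conj_by C P * conj_by C Q"
proof -
  note c = unitary_matD[OF assms(1)]
  have "conj_by C P * conj_by C Q = (mat_adjoint C * P * C) * (mat_adjoint C * (Q * C))"
    using c assms by (simp add: conj_by_def assoc_mult_mat[of _ d d _ d _ d])
  also have "\<dots> = (mat_adjoint C * P) * (Q * C)"
    using c assms by (intro mat_cancel_mid[where d = d]) simp_all
  also have "\<dots> = conj_by C (P * Q)"
    using c assms by (simp add: conj_by_def assoc_mult_mat[of _ d d _ d _ d] mult_carrier_mat[of _ d d _ d])
  finally show ?thesis ..
qed

lemma conj_by_smult:
  assumes "C \<in> carrier_mat d d" "P \<in> carrier_mat d d"
  shows "conj_by C (c \<cdot>\<^sub>m P) = c \<cdot>\<^sub>m conj_by C P"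
  using assms mat_adjoint_carrier[OF assms(1)]
  by (simp add: conj_by_def mult_smult_distrib[of _ d d _ d] mult_smult_assoc_mat[of _ d d _ d])

lemma conj_by_add:
  assumes "C \<in> carrier_mat d d" "P \<in> carrier_mat d d" "Q \<in> carrier_mat d d"
  shows "conj_by C (P + Q) = conj_by C P + conj_by C Q"
  using assms mat_adjoint_carrier[OF assms(1)]
  by (simp add: conj_by_def mult_add_distrib_mat[of _ d d _ d] add_mult_distrib_mat[of _ d d _ _ d] mult_carrier_mat[of _ d d _ d])

lemma conj_by_one: "unitary_mat d C \<Longrightarrow> conj_by C (1\<^sub>m d) = 1\<^sub>m d"
  by (auto simp: conj_by_def unitary_mat_def right_mult_one_mat[OF mat_adjoint_carrier])

lemma conj_by_comp:
  assumes "A \<in> carrier_mat d d" "B \<in> carrier_mat d d" "P \<in> carrier_mat d d"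
  shows "conj_by (A * B) P = conj_by B (conj_by A P)"
  using assms mat_adjoint_carrier[OF assms(1)] mat_adjoint_carrier[OF assms(2)]
  by (simp add: conj_by_def mat_adjoint_mult[OF assms(1,2)] assoc_mult_mat[of _ d d _ d _ d] mult_carrier_mat[of _ d d _ d])

lemma conj_by_cancel:
  assumes C: "unitary_mat d C" and "P \<in> carrier_mat d d"
  shows "conj_by (mat_adjoint C) (conj_by C P) = P" "conj_by C (conj_by (mat_adjoint C) P) = P"
  using unitary_matD[OF C] assms mat_adjoint_one[of d]
  by (auto simp: conj_by_comp[symmetric, where d = d] conj_by_def[of "1\<^sub>m d"])

lemma mult_conj_by:
  assumes "unitary_mat d C" "P \<in> carrier_mat d d"
  shows "C * conj_by C P = P * C"
proof -
  note c = unitary_matD[OF assms(1)]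
  have "C * conj_by C P = (C * mat_adjoint C) * (P * C)"
    unfolding conj_by_def assoc_mult_mat[OF c(2) assms(2) c(1)]
    by (rule assoc_mult_mat[symmetric, OF c(1,2) mult_carrier_mat[OF assms(2) c(1)]])
  also have "\<dots> = P * C"
    unfolding c(4) using c(1) assms(2) by (intro left_mult_one_mat) (rule mult_carrier_mat)
  finally show ?thesis .
qed

text \<open>The Clifford group described through its action on Pauli operators rather than by
  generating gates, so layers and rotations qualify without being decomposed into gates.\<close>

definition clifford :: "nat \<Rightarrow> complex mat \<Rightarrow> bool" where
  "clifford n C \<longleftrightarrow> unitary_mat (2 ^ n) C \<and> (\<forall>P\<in>paulis n. conj_by C P \<in> paulis n)"

lemma clifford_unitary: "clifford n C \<Longrightarrow> unitary_mat (2 ^ n) C"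
  and clifford_conj: "clifford n C \<Longrightarrow> P \<in> paulis n \<Longrightarrow> conj_by C P \<in> paulis n"
  by (simp_all add: clifford_def)

lemma cliffordI:
  assumes U: "unitary_mat (2 ^ n) C" and "\<And>a b. conj_by C (pauli n a b) \<in> paulis n"
  shows "clifford n C"
  unfolding clifford_def
proof (intro conjI ballI U)
  fix P assume "P \<in> paulis n"
  then obtain c a b where P: "P = c \<cdot>\<^sub>m pauli n a b" by (rule paulisE)
  show "conj_by C P \<in> paulis n"
    unfolding P conj_by_smult[OF unitary_matD(1)[OF U] pauli_carrier] by (intro smult_in_paulis assms)
qed

lemma clifford_one: "clifford n (1\<^sub>m (2 ^ n))"
  by (rule cliffordI[OF unitary_mat_one]) (simp add: conj_by_def mat_adjoint_one)

lemma clifford_mult: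
  assumes "clifford n A" "clifford n B"
  shows "clifford n (A * B)"
proof (rule cliffordI)
  note u = clifford_unitary[OF assms(1)] clifford_unitary[OF assms(2)]
  show "unitary_mat (2 ^ n) (A * B)" using u by (rule unitary_mat_mult)
  show "conj_by (A * B) (pauli n a b) \<in> paulis n" for a b
    using u assms by (simp add: conj_by_comp[where d = "2 ^ n"] unitary_matD(1) clifford_conj)
qed

text \<open>The one-qubit form, with explicit images so that they can be assembled qubitwise in a
  tensor product.\<close>

definition local_clifford :: "complex mat \<Rightarrow> bool" where
  "local_clifford U \<longleftrightarrow> unitary_mat 2 U \<and> (\<forall>a b. \<exists>c a' b'. conj_by U (pauli1 a b) = c \<cdot>\<^sub>m pauli1 a' b')"

lemma local_cliffordI:
  assumes "unitary_mat 2 U" "\<And>a b. conj_by U (pauli1 a b) = c a b \<cdot>\<^sub>m pauli1 (f a b) (g a b)"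
  shows "local_clifford U"
  unfolding local_clifford_def
proof (intro conjI allI assms(1))
  fix a b
  show "\<exists>c a' b'. conj_by U (pauli1 a b) = c \<cdot>\<^sub>m pauli1 a' b'"
    by (intro exI, rule assms(2)[of a b])
qed

lemma local_cliffordE:
  assumes "local_clifford U"
  obtains c a' b' where "conj_by U (pauli1 a b) = c \<cdot>\<^sub>m pauli1 a' b'"
  using conjunct2[OF assms[unfolded local_clifford_def], THEN spec, THEN spec, of a b]
  by (elim exE) (rule that)

lemma local_clifford_unitary: "local_clifford U \<Longrightarrow> unitary_mat 2 U"
  by (simp add: local_clifford_def)

lemma local_clifford_one: "local_clifford (1\<^sub>m 2)"
  by (rule local_cliffordI[where c = "\<lambda>_ _. 1" and f = "\<lambda>a b. a" and g = "\<lambda>a b. b"])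
    (simp_all add: unitary_mat_one conj_by_def mat_adjoint_one)

lemma local_clifford_mult:
  assumes "local_clifford U" "local_clifford V"
  shows "local_clifford (U * V)"
  unfolding local_clifford_def
proof (intro conjI allI)
  note u = local_clifford_unitary[OF assms(1)] local_clifford_unitary[OF assms(2)]
  then show "unitary_mat 2 (U * V)" by (rule unitary_mat_mult)
  fix a b
  obtain c a' b' where 1: "conj_by U (pauli1 a b) = c \<cdot>\<^sub>m pauli1 a' b'"
    using assms(1) by (rule local_cliffordE)
  obtain d a'' b'' where 2: "conj_by V (pauli1 a' b') = d \<cdot>\<^sub>m pauli1 a'' b''"
    using assms(2) by (rule local_cliffordE)
  have "conj_by (U * V) (pauli1 a b) = (c * d) \<cdot>\<^sub>m pauli1 a'' b''"
    using u by (simp add: conj_by_comp[where d = 2] unitary_matD(1) 1 2 conj_by_smult[where d = 2] smult_smult_mat)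
  then show "\<exists>c a' b'. conj_by (U * V) (pauli1 a b) = c \<cdot>\<^sub>m pauli1 a' b'" by (intro exI)
qed

lemma S_mat_dim [simp]: "dim_row S_mat = 2" "dim_col S_mat = 2"
  using carrier_matD[OF S_mat_carrier] by simp_all

lemma S_mat_unitary: "unitary_mat 2 S_mat"
  unfolding unitary_mat_def
  by (intro conjI mat2_eqI) (auto simp: mat2_mult_index mult_carrier_mat[of _ 2 2 _ 2] mat_adjoint_carrier simp del: index_mult_mat)

lemma conj_by_hadamard: "conj_by hadamard (pauli1 a b) = (if a \<and> b then -1 else 1) \<cdot>\<^sub>m pauli1 b a"
  unfolding conj_by_def hadamard_adjoint
  by (rule mat2_eqI) (auto simp: mat2_mult_index mult_carrier_mat[of _ 2 2 _ 2] inv_sqrt2_sq simp del: index_mult_mat)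

lemma conj_by_S_mat: "conj_by S_mat (pauli1 a b) = (if a then - \<i> else 1) \<cdot>\<^sub>m pauli1 a (a \<noteq> b)"
  unfolding conj_by_def
  by (rule mat2_eqI) (auto simp: mat2_mult_index mult_carrier_mat[of _ 2 2 _ 2] mat_adjoint_carrier simp del: index_mult_mat)

lemma local_clifford_hadamard: "local_clifford hadamard"
  by (rule local_cliffordI[OF hadamard_unitary conj_by_hadamard])

lemma local_clifford_S_mat: "local_clifford S_mat"
  by (rule local_cliffordI[OF S_mat_unitary conj_by_S_mat])

lemma conj_by_tensor:
  assumes "\<And>q. q < n \<Longrightarrow> U q \<in> carrier_mat 2 2"
    "\<And>q. q < n \<Longrightarrow> conj_by (U q) (pauli1 (a q) (b q)) = c q \<cdot>\<^sub>m pauli1 (a' q) (b' q)"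
  shows "conj_by (tensor n U) (pauli n a b) = (\<Prod>q<n. c q) \<cdot>\<^sub>m pauli n a' b'"
proof -
  have "conj_by (tensor n U) (pauli n a b) = tensor n (\<lambda>q. conj_by (U q) (pauli1 (a q) (b q)))"
    using assms(1) by (simp add: conj_by_def pauli_def tensor_adjoint tensor_mult mat_adjoint_carrier mult_carrier_mat[of _ 2 2 _ 2])
  also have "\<dots> = tensor n (\<lambda>q. c q \<cdot>\<^sub>m pauli1 (a' q) (b' q))"
    using assms(2) by (intro tensor_cong)
  finally show ?thesis by (simp add: tensor_smult pauli_def)
qed

lemma clifford_tensor:
  assumes "\<And>q. q < n \<Longrightarrow> local_clifford (U q)"
  shows "clifford n (tensor n U)"
proof (rule cliffordI)
  have u: "unitary_mat 2 (U q)" if "q < n" for q using assms[OF that] by (rule local_clifford_unitary)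
  then show "unitary_mat (2 ^ n) (tensor n U)" by (rule tensor_unitary)
  fix a b
  have "\<exists>c a' b'. q < n \<longrightarrow> conj_by (U q) (pauli1 (a q) (b q)) = c \<cdot>\<^sub>m pauli1 a' b'" for q
    using assms[of q] by (cases "q < n") (simp_all add: local_clifford_def)
  then obtain c a' b' where c: "\<And>q. q < n \<Longrightarrow> conj_by (U q) (pauli1 (a q) (b q)) = c q \<cdot>\<^sub>m pauli1 (a' q) (b' q)"
    by metis
  have "conj_by (tensor n U) (pauli n a b) = (\<Prod>q<n. c q) \<cdot>\<^sub>m pauli n a' b'"
    by (rule conj_by_tensor[OF unitary_matD(1)[OF u] c])
  then show "conj_by (tensor n U) (pauli n a b) \<in> paulis n" by (simp add: smult_in_paulis)
qed

lemma clifford_on_qubit: "q < n \<Longrightarrow> local_clifford U \<Longrightarrow> clifford n (on_qubit n q U)"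
  by (auto simp: on_qubit_tensor local_clifford_one intro: clifford_tensor)

text \<open>Conjugation multiplies the entry at \<open>(r, c)\<close> by
  \<open>cnj (d r) * d c\<close>. If on the nonzero entries this factor is, up to a scalar, a sign
  character of the bits of \<open>c\<close>, then it acts as a Z-type operator multiplied from the
  right.\<close>

lemma conj_by_diagm:
  assumes "\<And>r c. r < 2 ^ n \<Longrightarrow> c < 2 ^ n \<Longrightarrow> (\<And>q. q < n \<Longrightarrow> (bit r q \<noteq> bit c q) = a q) \<Longrightarrow>
      cnj (d r) * d c = s * (\<Prod>q<n. if e q \<and> bit c q then -1 else 1)"
  shows "conj_by (diagm n d) (pauli n a b) = s \<cdot>\<^sub>m (pauli n a b * pauli n (\<lambda>_. False) e)"
proof (rule eq_matI)
  fix r c assume "r < dim_row (s \<cdot>\<^sub>m (pauli n a b * pauli n (\<lambda>_. False) e))"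
    "c < dim_col (s \<cdot>\<^sub>m (pauli n a b * pauli n (\<lambda>_. False) e))"
  then have rc: "r < 2 ^ n" "c < 2 ^ n" by auto
  have "conj_by (diagm n d) (pauli n a b) $$ (r, c) = cnj (d r) * pauli n a b $$ (r, c) * d c"
    unfolding conj_by_def diagm_adjoint
    by (simp only: diagm_mult_right_index[OF mult_carrier_mat[OF diagm_carrier pauli_carrier] rc]
        diagm_mult_left_index[OF pauli_carrier rc])
  also have "\<dots> = s * (pauli n a b $$ (r, c) * (\<Prod>q<n. if e q \<and> bit c q then -1 else 1))"
  proof (cases "\<forall>q<n. (bit r q \<noteq> bit c q) = a q")
    case True
    then have e: "cnj (d r) * d c = s * (\<Prod>q<n. if e q \<and> bit c q then -1 else 1)" using assms[OF rc] by blast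
    have "cnj (d r) * pauli n a b $$ (r, c) * d c = (cnj (d r) * d c) * pauli n a b $$ (r, c)"
      by (simp only: mult_ac)
    then show ?thesis unfolding e by (simp only: mult_ac)
  next
    case False
    then have "pauli n a b $$ (r, c) = 0" by (simp only: pauli_index[OF rc] if_False)
    then show ?thesis by simp
  qed
  also have "\<dots> = (s \<cdot>\<^sub>m (pauli n a b * pauli n (\<lambda>_. False) e)) $$ (r, c)"
    unfolding pauli_Z_type using rc
    by (subst index_smult_mat(1)) (simp_all only: diagm_mult_right_index[OF pauli_carrier rc] index_mult_mat(2,3)
        pauli_dim carrier_matD[OF diagm_carrier])
  finally show "conj_by (diagm n d) (pauli n a b) $$ (r, c) = (s \<cdot>\<^sub>m (pauli n a b * pauli n (\<lambda>_. False) e)) $$ (r, c)" .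
qed (auto simp: conj_by_def diagm_def)

lemma clifford_cz:
  assumes pq: "p < n" "q < n" "p \<noteq> q"
  shows "clifford n (cz_mat n p q)"
proof -
  let ?d = "\<lambda>c. if bit c p \<and> bit c q then -1 else 1 :: complex"
  have cz: "cz_mat n p q = diagm n ?d"
    by (rule eq_matI) (auto simp: cz_mat_def diagm_def)
  show ?thesis
    unfolding cz
  proof (rule cliffordI)
    show "unitary_mat (2 ^ n) (diagm n ?d)" by (rule diagm_unitary) simp
    fix a b :: "nat \<Rightarrow> bool"
    \<comment> \<open>An \<open>X\<close> on either qubit picks up a \<open>Z\<close> on the other
      one; the sign appears when both qubits carry an \<open>X\<close>.\<close>
    let ?e = "\<lambda>x. x = p \<and> a q \<or> x = q \<and> a p"
    have "conj_by (diagm n ?d) (pauli n a b) = (if a p \<and> a q then -1 else 1) \<cdot>\<^sub>m (pauli n a b * pauli n (\<lambda>_. False) ?e)"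
    proof (rule conj_by_diagm)
      fix r c :: nat assume *: "\<And>x. x < n \<Longrightarrow> (bit r x \<noteq> bit c x) = a x"
      have "(\<Prod>x<n. if ?e x \<and> bit c x then -1 else 1 :: complex) = (\<Prod>x\<in>{p, q}. if ?e x \<and> bit c x then -1 else 1)"
        using pq by (intro prod.mono_neutral_right) auto
      also have "\<dots> = (if a q \<and> bit c p then -1 else 1) * (if a p \<and> bit c q then -1 else 1)"
        using pq by auto
      finally show "cnj (?d r) * ?d c = (if a p \<and> a q then -1 else 1) * (\<Prod>x<n. if ?e x \<and> bit c x then -1 else 1)"
        using *[OF pq(1)] *[OF pq(2)] by (cases "bit c p"; cases "bit c q"; cases "bit r p"; cases "bit r q") auto
    qed
    then show "conj_by (diagm n ?d) (pauli n a b) \<in> paulis n"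
      by (simp add: smult_in_paulis paulis_mult)
  qed
qed

lemma even_card_xor:
  assumes "finite A"
  shows "even (card {q \<in> A. f q \<noteq> g q}) \<longleftrightarrow> (even (card {q \<in> A. f q}) \<longleftrightarrow> even (card {q \<in> A. g q}))"
  using assms
proof (induction A rule: finite_induct)
  case (insert i A)
  have "{q \<in> insert i A. h q} = (if h i then insert i {q \<in> A. h q} else {q \<in> A. h q})" for h by auto
  then have "card {q \<in> insert i A. h q} = (if h i then Suc (card {q \<in> A. h q}) else card {q \<in> A. h q})" for h
    using insert.hyps by simp
  then show ?case using insert by auto
qed simp

lemma prod_sign_card:
  assumes "finite A"
  shows "(\<Prod>q\<in>A. if e \<and> f q then -1 else 1 :: complex) = (if e \<and> odd (card {q \<in> A. f q}) then -1 else 1)"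
  using assms
proof (induction A rule: finite_induct)
  case (insert i A)
  have "{q \<in> insert i A. f q} = (if f i then insert i {q \<in> A. f q} else {q \<in> A. f q})" by auto
  then show ?case using insert by auto
qed simp

text \<open>An \<open>X\<close> on one side of the bipartition leaves a \<open>Z\<close> on every
  qubit of the other side, so only the parities of the X-parts on the two sides matter. The sign
  \<open>s\<close> is left open.\<close>

lemma conj_by_cz_layer:
  assumes B: "B \<subseteq> {..<n}"
  shows "\<exists>s. conj_by (cz_layer n B) (pauli n a b) = s \<cdot>\<^sub>m (pauli n a b * pauli n (\<lambda>_. False)
    (\<lambda>q. if q \<in> B then odd (card {q \<in> {..<n} - B. a q}) else odd (card {q \<in> B. a q})))"
proof -
  define A where "A = {..<n} - B"
  have fin: "finite A" "finite B" using B finite_subset by (auto simp: A_def)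
  have un: "{..<n} = A \<union> B" "A \<inter> B = {}" using B by (auto simp: A_def)
  let ?\<alpha> = "odd (card {q \<in> A. a q})" and ?\<beta> = "odd (card {q \<in> B. a q})"
  let ?e = "\<lambda>q. if q \<in> B then ?\<alpha> else ?\<beta>"
  have "conj_by (cz_layer n B) (pauli n a b) = (if ?\<alpha> \<and> ?\<beta> then -1 else 1) \<cdot>\<^sub>m (pauli n a b * pauli n (\<lambda>_. False) ?e)"
    unfolding cz_layer_def A_def[symmetric]
  proof (rule conj_by_diagm)
    fix r c :: nat assume *: "\<And>x. x < n \<Longrightarrow> (bit r x \<noteq> bit c x) = a x"
    have "{q \<in> A. bit r q} = {q \<in> A. bit c q \<noteq> a q}" "{q \<in> B. bit r q} = {q \<in> B. bit c q \<noteq> a q}"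
      using * un by auto
    then have ev: "even (card {q \<in> A. bit r q}) \<longleftrightarrow> (even (card {q \<in> A. bit c q}) \<longleftrightarrow> even (card {q \<in> A. a q}))"
      "even (card {q \<in> B. bit r q}) \<longleftrightarrow> (even (card {q \<in> B. bit c q}) \<longleftrightarrow> even (card {q \<in> B. a q}))"
      by (simp_all only: even_card_xor[OF fin(1)] even_card_xor[OF fin(2)])
    have "(\<Prod>q<n. if ?e q \<and> bit c q then -1 else 1 :: complex) =
      (\<Prod>q\<in>A. if ?e q \<and> bit c q then -1 else 1) * (\<Prod>q\<in>B. if ?e q \<and> bit c q then -1 else 1)"
      unfolding un(1) using fin un(2) by (rule prod.union_disjoint)
    also have "(\<Prod>q\<in>A. if ?e q \<and> bit c q then -1 else 1 :: complex) = (\<Prod>q\<in>A. if ?\<beta> \<and> bit c q then -1 else 1)"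
      using un by (intro prod.cong) auto
    also have "(\<Prod>q\<in>B. if ?e q \<and> bit c q then -1 else 1 :: complex) = (\<Prod>q\<in>B. if ?\<alpha> \<and> bit c q then -1 else 1)"
      using un by (intro prod.cong) auto
    \<comment> \<open>With \<open>x\<close>, \<open>y\<close> the numbers of set bits of
      \<open>c\<close> on the two sides, and ?\<alpha>, ?\<beta> read as 0 or 1, this is \<open>(x +
      ?\<alpha>) * (y + ?\<beta>) + x * y = ?\<alpha> * y + ?\<beta> * x + ?\<alpha> *
      ?\<beta>\<close> modulo 2, checked over all parities.\<close>
    finally show "cnj ((- 1) ^ (card {q \<in> A. bit r q} * card {q \<in> B. bit r q})) *
        (- 1) ^ (card {q \<in> A. bit c q} * card {q \<in> B. bit c q}) =
       (if ?\<alpha> \<and> ?\<beta> then -1 else 1) * (\<Prod>q<n. if ?e q \<and> bit c q then -1 else 1)"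
      unfolding prod_sign_card[OF fin(1)] prod_sign_card[OF fin(2)]
      using ev
      by (cases "even (card {q \<in> A. bit c q})"; cases "even (card {q \<in> B. bit c q})";
          cases "even (card {q \<in> A. a q})"; cases "even (card {q \<in> B. a q})")
        (simp_all add: minus_one_power_iff)
  qed
  then show ?thesis unfolding A_def by blast
qed

lemma cz_layer_unitary: "unitary_mat (2 ^ n) (cz_layer n B)"
  unfolding cz_layer_def by (rule diagm_unitary) (simp add: norm_power)

lemma cz_layer_adjoint: "mat_adjoint (cz_layer n B) = cz_layer n B"
  by (simp add: cz_layer_def diagm_adjoint)

lemma clifford_cz_layer:
  assumes "B \<subseteq> {..<n}"
  shows "clifford n (cz_layer n B)"
proof (rule cliffordI[OF cz_layer_unitary])
  fix a b
  show "conj_by (cz_layer n B) (pauli n a b) \<in> paulis n"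
    using conj_by_cz_layer[OF assms, of a b] by (auto intro!: smult_in_paulis paulis_mult)
qed

lemma prod_split_two:
  assumes "finite A" "p \<in> A" "q \<in> A" "p \<noteq> q"
  shows "prod g A = g p * (g q * prod g (A - {p} - {q}))"
  using assms by (simp add: prod.remove[of A p] prod.remove[of "A - {p}" q])

text \<open>The gate permutes the basis states by the involution \<open>f\<close>, so conjugation
  just relabels both indices of an entry.\<close>

lemma clifford_cnot:
  assumes pq: "p < n" "q < n" "p \<noteq> q"
  shows "clifford n (cnot_mat n p q)"
proof -
  define f where "f = (\<lambda>c. if bit c p then flip_bit q c else c :: nat)"
  have bf: "bit (f c) x \<longleftrightarrow> (if x = q then bit c q \<noteq> bit c p else bit c x)" for c x
    by (auto simp: f_def bit_flip_bit_iff)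
  have ff: "f (f c) = c" for c
    by (rule bit_eqI) (use pq in \<open>auto simp: bf\<close>)
  have f_less: "f c < 2 ^ n" if "c < 2 ^ n" for c
  proof -
    have "take_bit n (f c) = f c"
    proof (rule bit_eqI)
      fix x
      have "bit c x \<Longrightarrow> x < n" for x
        using that by (metis bit_take_bit_iff take_bit_nat_eq_self)
      then show "bit (take_bit n (f c)) x = bit (f c) x"
        using pq by (auto simp: bit_take_bit_iff bf split: if_splits)
    qed
    then show ?thesis by (metis take_bit_nat_less_exp)
  qed
  let ?M = "cnot_mat n p q"
  have M: "?M \<in> carrier_mat (2 ^ n) (2 ^ n)" by (simp add: cnot_mat_def)
  have Mi: "?M $$ (r, c) = of_bool (r = f c)" if "r < 2 ^ n" "c < 2 ^ n" for r c
    using that by (simp add: cnot_mat_def f_def)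
  have adj: "mat_adjoint ?M = ?M"
  proof (rule eq_matI)
    fix r c assume "r < dim_row ?M" "c < dim_col ?M"
    then have rc: "r < 2 ^ n" "c < 2 ^ n" using M by auto
    have "c = f r \<longleftrightarrow> r = f c" using ff by metis
    then show "mat_adjoint ?M $$ (r, c) = ?M $$ (r, c)"
      using rc M by (simp add: Mi)
  qed (use M in auto)
  have left: "(?M * N) $$ (r, c) = N $$ (f r, c)"
    if N: "N \<in> carrier_mat (2 ^ n) (2 ^ n)" and rc: "r < 2 ^ n" "c < 2 ^ n" for N r c
  proof -
    have "(?M * N) $$ (r, c) = (\<Sum>k<2 ^ n. if k = f r then N $$ (f r, c) else 0)"
      unfolding mat_mult_index_sum[OF M N rc]
    proof (intro sum.cong refl)
      fix k :: nat assume "k \<in> {..<2 ^ n}"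
      moreover have "r = f k \<longleftrightarrow> k = f r" using ff by metis
      ultimately show "?M $$ (r, k) * N $$ (k, c) = (if k = f r then N $$ (f r, c) else 0)"
        using rc by (auto simp: Mi)
    qed
    then show ?thesis using f_less[OF rc(1)] by simp
  qed
  have right: "(N * ?M) $$ (r, c) = N $$ (r, f c)"
    if N: "N \<in> carrier_mat (2 ^ n) (2 ^ n)" and rc: "r < 2 ^ n" "c < 2 ^ n" for N r c
  proof -
    have "(N * ?M) $$ (r, c) = (\<Sum>k<2 ^ n. if k = f c then N $$ (r, f c) else 0)"
      unfolding mat_mult_index_sum[OF N M rc] using rc by (intro sum.cong refl) (auto simp: Mi)
    then show ?thesis using f_less[OF rc(2)] by simp
  qed
  have MM: "?M * ?M = 1\<^sub>m (2 ^ n)"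
  proof (rule eq_matI)
    fix r c assume "r < dim_row (1\<^sub>m (2 ^ n) :: complex mat)" "c < dim_col (1\<^sub>m (2 ^ n) :: complex mat)"
    then have rc: "r < 2 ^ n" "c < 2 ^ n" by auto
    have "f r = f c \<longleftrightarrow> r = c" using ff by metis
    then show "(?M * ?M) $$ (r, c) = 1\<^sub>m (2 ^ n) $$ (r, c)"
      unfolding left[OF M rc] Mi[OF f_less[OF rc(1)] rc(2)] using rc by simp
  qed (use M in auto)
  show ?thesis
  proof (rule cliffordI)
    show "unitary_mat (2 ^ n) ?M" using M MM by (simp add: unitary_mat_def adj)
    fix a b
    \<comment> \<open>An \<open>X\<close> on the control spreads to the target and a
      \<open>Z\<close> on the target spreads to the control; no sign arises.\<close>
    let ?a = "\<lambda>x. if x = q then a q \<noteq> a p else a x" and ?b = "\<lambda>x. if x = p then b p \<noteq> b q else b x"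
    have "conj_by ?M (pauli n a b) = pauli n ?a ?b"
    proof (rule eq_matI)
      fix r c assume "r < dim_row (pauli n ?a ?b)" "c < dim_col (pauli n ?a ?b)"
      then have rc: "r < 2 ^ n" "c < 2 ^ n" by auto
      have "conj_by ?M (pauli n a b) $$ (r, c) = pauli n a b $$ (f r, f c)"
        unfolding conj_by_def adj right[OF mult_carrier_mat[OF M pauli_carrier] rc]
          left[OF pauli_carrier rc(1) f_less[OF rc(2)]] ..
      also have "\<dots> = pauli n ?a ?b $$ (r, c)"
      proof -
        have "(\<forall>x<n. (bit (f r) x \<noteq> bit (f c) x) = a x) \<longleftrightarrow> (\<forall>x<n. (bit r x \<noteq> bit c x) = ?a x)" (is "?L \<longleftrightarrow> ?R")
        proof
          assume L: ?L
          show ?R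
          proof (intro allI impI)
            fix x assume x: "x < n"
            show "(bit r x \<noteq> bit c x) = ?a x"
              using L[rule_format, OF x] L[rule_format, OF pq(1)] pq unfolding bf by (auto split: if_splits)
          qed
        next
          assume R: ?R
          show ?L
          proof (intro allI impI)
            fix x assume x: "x < n"
            show "(bit (f r) x \<noteq> bit (f c) x) = a x"
              using R[rule_format, OF x] R[rule_format, OF pq(1)] pq unfolding bf by (auto split: if_splits)
          qed
        qed
        moreover have "(\<Prod>x<n. if b x \<and> bit (f c) x then -1 else 1 :: complex) = (\<Prod>x<n. if ?b x \<and> bit c x then -1 else 1)"
        proof -
          have "(\<Prod>x\<in>{..<n} - {p} - {q}. if b x \<and> bit (f c) x then -1 else 1 :: complex) =
            (\<Prod>x\<in>{..<n} - {p} - {q}. if ?b x \<and> bit c x then -1 else 1)"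
            by (intro prod.cong refl) (auto simp: bf)
          moreover have "(if b p \<and> bit (f c) p then -1 else 1) * ((if b q \<and> bit (f c) q then -1 else 1) * z) =
            (if ?b p \<and> bit c p then -1 else 1) * ((if ?b q \<and> bit c q then -1 else 1) * z)" for z :: complex
            using pq by (auto simp: bf)
          ultimately show ?thesis
            using pq by (simp only: prod_split_two[of "{..<n}" p q] finite_lessThan lessThan_iff simp_thms)
        qed
        ultimately show ?thesis
          unfolding pauli_index[OF rc] pauli_index[OF f_less[OF rc(1)] f_less[OF rc(2)]] by (simp only:)
      qed
      finally show "conj_by ?M (pauli n a b) $$ (r, c) = pauli n ?a ?b $$ (r, c)" .
    qed (use M in \<open>auto simp: conj_by_def\<close>)
    then show "conj_by ?M (pauli n a b) \<in> paulis n" by simp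
  qed
qed

lemma clifford_gate_mat: "valid_gate n g \<Longrightarrow> clifford_gate g \<Longrightarrow> clifford n (gate_mat n g)"
  by (cases g) (auto intro: clifford_on_qubit local_clifford_S_mat local_clifford_hadamard clifford_cnot clifford_cz)

section \<open>Reduction of a Pauli operator to a single qubit\<close>

abbreviation pauli_x :: "nat \<Rightarrow> nat \<Rightarrow> complex mat" where
  "pauli_x n q \<equiv> pauli n (\<lambda>p. p = q) (\<lambda>_. False)"

abbreviation pauli_z :: "nat \<Rightarrow> nat \<Rightarrow> complex mat" where
  "pauli_z n q \<equiv> pauli n (\<lambda>_. False) (\<lambda>p. p = q)"

lemma on_qubit_pauli_X: "q < n \<Longrightarrow> on_qubit n q pauli_X = pauli_x n q"
proof -
  have "pauli1 True False = pauli_X" by (rule mat2_eqI) auto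
  then show "q < n \<Longrightarrow> on_qubit n q pauli_X = pauli_x n q"
    by (auto simp: on_qubit_tensor pauli_def pauli1_one intro!: tensor_cong)
qed

lemma on_qubit_pauli_Z: "q < n \<Longrightarrow> on_qubit n q pauli_Z = pauli_z n q"
proof -
  have "pauli1 False True = pauli_Z" by (rule mat2_eqI) auto
  then show "q < n \<Longrightarrow> on_qubit n q pauli_Z = pauli_z n q"
    by (auto simp: on_qubit_tensor pauli_def pauli1_one intro!: tensor_cong)
qed

text \<open>The identity serves for \<open>X\<close>, the Hadamard gate for \<open>Z\<close>, and
  \<open>S\<close>, which multiplies \<open>X\<close> by \<open>Z\<close> up to phase, for
  \<open>X Z\<close>.\<close>

lemma local_clifford_to_X:
  assumes "a \<or> b"
  shows "\<exists>U c. local_clifford U \<and> conj_by U (pauli1 a b) = c \<cdot>\<^sub>m pauli1 True False"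
proof -
  have 1: "conj_by (1\<^sub>m 2) (pauli1 True False) = 1 \<cdot>\<^sub>m pauli1 True False"
    by (simp add: conj_by_def mat_adjoint_one)
  consider "a" "\<not> b" | "\<not> a" "b" | "a" "b" using assms by blast
  then show ?thesis
  proof cases
    case 1
    then show ?thesis using local_clifford_one \<open>conj_by (1\<^sub>m 2) _ = _\<close> by (intro exI conjI) auto
  next
    case 2
    then show ?thesis using local_clifford_hadamard conj_by_hadamard[of False True] by (intro exI conjI) auto
  next
    case 3
    then show ?thesis using local_clifford_S_mat conj_by_S_mat[of True True] by (intro exI conjI) auto
  qed
qed

lemma local_clifford_to_Z:
  assumes "a \<or> b"
  shows "\<exists>U c. local_clifford U \<and> conj_by U (pauli1 a b) = c \<cdot>\<^sub>m pauli1 False True"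
proof -
  obtain U c where U: "local_clifford U" "conj_by U (pauli1 a b) = c \<cdot>\<^sub>m pauli1 True False"
    using local_clifford_to_X[OF assms] by (elim exE conjE)
  have "conj_by (U * hadamard) (pauli1 a b) = conj_by hadamard (c \<cdot>\<^sub>m pauli1 True False)"
    using unitary_matD(1)[OF local_clifford_unitary[OF U(1)]] by (simp add: conj_by_comp[where d = 2] U(2))
  also have "\<dots> = c \<cdot>\<^sub>m pauli1 False True"
    by (simp add: conj_by_smult[where d = 2] conj_by_hadamard)
  finally show ?thesis
    using local_clifford_mult[OF U(1) local_clifford_hadamard] by (intro exI conjI)
qed

text \<open>One-qubit Clifford gates first turn the operator into \<open>X\<close> on
  \<open>v\<close> and \<open>Z\<close> on the rest \<open>B\<close> of its support; the layer then
  cancels every \<open>Z\<close> on \<open>B\<close>. The layer is self-adjoint, so the adjoint of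
  \<open>V\<close> has the same cost.\<close>

lemma pauli_reduce:
  assumes v: "v < n" "a v \<or> b v"
  shows "\<exists>V c. clifford n V \<and> gmsable n 2 V \<and> gmsable n 2 (mat_adjoint V) \<and>
    conj_by V (pauli n a b) = c \<cdot>\<^sub>m pauli_x n v"
proof -
  define b' where "b' = (\<lambda>q. q \<noteq> v \<and> (a q \<or> b q))"
  have "\<exists>U c. local_clifford U \<and> conj_by U (pauli1 (a q) (b q)) = c \<cdot>\<^sub>m pauli1 (q = v) (b' q)" for q
  proof (cases "a q \<or> b q")
    case True
    then show ?thesis
      using local_clifford_to_X[OF True] local_clifford_to_Z[OF True] by (cases "q = v") (simp_all add: b'_def)
  next
    case False
    then have "q \<noteq> v" using v by auto
    have "conj_by (1\<^sub>m 2) (pauli1 False False) = 1 \<cdot>\<^sub>m pauli1 False False"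
      by (simp add: conj_by_def mat_adjoint_one)
    then show ?thesis
      using False \<open>q \<noteq> v\<close> local_clifford_one by (intro exI[of _ "1\<^sub>m 2"] exI[of _ 1]) (simp add: b'_def)
  qed
  then obtain U c where U: "\<And>q. local_clifford (U q)"
    "\<And>q. conj_by (U q) (pauli1 (a q) (b q)) = c q \<cdot>\<^sub>m pauli1 (q = v) (b' q)"
    by metis
  define B where "B = {q. q < n \<and> b' q}"
  have B: "B \<subseteq> {..<n}" by (auto simp: B_def)
  let ?K = "cz_layer n B"
  let ?V = "tensor n U * ?K"
  note u = local_clifford_unitary[OF U(1)]
  have K: "?K \<in> carrier_mat (2 ^ n) (2 ^ n)" by (simp add: cz_layer_def)
  have 1: "clifford n ?V"
    by (intro clifford_mult clifford_tensor U clifford_cz_layer B)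
  have 2: "gmsable n (0 + 2) ?V"
    by (intro gmsable_mult gmsable_tensor u gmsable_cz_layer B)
  have "mat_adjoint ?V = ?K * tensor n (\<lambda>q. mat_adjoint (U q))"
    using mat_adjoint_mult[OF tensor_carrier K] unitary_matD(1)[OF u]
    by (simp add: cz_layer_adjoint tensor_adjoint)
  moreover have "gmsable n (2 + 0) (?K * tensor n (\<lambda>q. mat_adjoint (U q)))"
    by (intro gmsable_mult gmsable_tensor unitary_mat_adjoint u gmsable_cz_layer B)
  ultimately have 3: "gmsable n 2 (mat_adjoint ?V)" by simp
  \<comment> \<open>The only \<open>X\<close> sits on \<open>v\<close>, outside \<open>B\<close>:
    the X-parity is odd outside \<open>B\<close> and even inside, so the layer adds \<open>Z\<close>
    precisely on \<open>B\<close>.\<close>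
  have vB: "{q \<in> {..<n} - B. q = v} = {v}" "{q \<in> B. q = v} = {}"
    using v by (auto simp: B_def b'_def)
  have e: "(\<lambda>q. if q \<in> B then odd (card {q \<in> {..<n} - B. q = v}) else odd (card {q \<in> B. q = v})) = (\<lambda>q. q \<in> B)"
    unfolding vB by simp
  obtain s where s: "conj_by ?K (pauli n (\<lambda>q. q = v) b') = s \<cdot>\<^sub>m (pauli n (\<lambda>q. q = v) b' * pauli n (\<lambda>_. False) (\<lambda>q. q \<in> B))"
    using conj_by_cz_layer[OF B, of "\<lambda>q. q = v" b'] unfolding e by (elim exE) (rule that)
  have x: "pauli n (\<lambda>q. q = v) b' * pauli n (\<lambda>_. False) (\<lambda>q. q \<in> B) = pauli_x n v"
    unfolding pauli_mult by (simp, rule pauli_cong) (auto simp: B_def)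
  have "conj_by ?V (pauli n a b) = conj_by ?K (conj_by (tensor n U) (pauli n a b))"
    by (rule conj_by_comp[OF tensor_carrier K pauli_carrier])
  also have "conj_by (tensor n U) (pauli n a b) = (\<Prod>q<n. c q) \<cdot>\<^sub>m pauli n (\<lambda>q. q = v) b'"
    using unitary_matD(1)[OF u] U(2) by (intro conj_by_tensor)
  also have "conj_by ?K \<dots> = ((\<Prod>q<n. c q) * s) \<cdot>\<^sub>m pauli_x n v"
    unfolding conj_by_smult[OF K pauli_carrier] s x smult_smult_mat ..
  finally show ?thesis
    using 1 2[unfolded add_0_left] 3 by (intro exI[of _ ?V] exI[of _ "(\<Prod>q<n. c q) * s"] conjI)
qed

lemma on_qubit_one: "q < n \<Longrightarrow> on_qubit n q (1\<^sub>m 2) = 1\<^sub>m (2 ^ n)"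
  by (simp add: on_qubit_tensor tensor_one)

lemma on_qubit_linear:
  assumes "A \<in> carrier_mat 2 2" "B \<in> carrier_mat 2 2"
  shows "on_qubit n q (x \<cdot>\<^sub>m A + y \<cdot>\<^sub>m B) = x \<cdot>\<^sub>m on_qubit n q A + y \<cdot>\<^sub>m on_qubit n q B"
proof -
  have "(x \<cdot>\<^sub>m A + y \<cdot>\<^sub>m B) $$ (of_bool i, of_bool j) = x * A $$ (of_bool i, of_bool j) + y * B $$ (of_bool i, of_bool j)" for i j
    using assms by auto
  then show ?thesis by (intro eq_matI) (auto simp: on_qubit_def)
qed

lemma on_qubit_index_qubit:
  assumes "q < n"
  shows "on_qubit n q U $$ (of_bool i * 2 ^ q, of_bool j * 2 ^ q) = U $$ (of_bool i, of_bool j)"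
proof -
  have "of_bool i * 2 ^ q < (2 :: nat) ^ n" "of_bool j * 2 ^ q < (2 :: nat) ^ n"
    using assms by (cases i; cases j; simp)+
  moreover have "bit (of_bool i * 2 ^ q :: nat) p \<longleftrightarrow> i \<and> p = q" for i p
    by (auto simp: bit_exp_iff)
  ultimately show ?thesis by (simp add: on_qubit_def)
qed

text \<open>Embedding a one-qubit matrix is injective and respects products and adjoints, so
  unitarity descends. Injectivity comes from reading the entries of \<open>U\<close> at basis states
  with all other qubits 0.\<close>

lemma on_qubit_unitary_imp:
  assumes q: "q < n" and U: "U \<in> carrier_mat 2 2" and un: "unitary_mat (2 ^ n) (on_qubit n q U)"
  shows "unitary_mat 2 U"
proof -
  have inj: "A = B" if "A \<in> carrier_mat 2 2" "B \<in> carrier_mat 2 2" "on_qubit n q A = on_qubit n q B" for A B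
  proof -
    have "A $$ (of_bool i, of_bool j) = B $$ (of_bool i, of_bool j)" for i j
      unfolding on_qubit_index_qubit[OF q, symmetric] that(3) ..
    from this[of False False] this[of False True] this[of True False] this[of True True] show ?thesis
      using that(1,2) by (intro mat2_eqI) simp_all
  qed
  have mult: "on_qubit n q A * on_qubit n q B = on_qubit n q (A * B)" if "A \<in> carrier_mat 2 2" "B \<in> carrier_mat 2 2" for A B
    using that q by (auto simp: on_qubit_tensor tensor_mult intro!: tensor_cong)
  have adj: "mat_adjoint (on_qubit n q U) = on_qubit n q (mat_adjoint U)"
    using U q by (auto simp: on_qubit_tensor tensor_adjoint mat_adjoint_one intro!: tensor_cong)
  note U' = mat_adjoint_carrier[OF U]
  have "on_qubit n q (mat_adjoint U * U) = on_qubit n q (1\<^sub>m 2)" "on_qubit n q (U * mat_adjoint U) = on_qubit n q (1\<^sub>m 2)"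
    using unitary_matD[OF un] by (simp_all add: adj mult U U' on_qubit_one q)
  then show ?thesis
    unfolding unitary_mat_def using U U' by (auto intro!: inj mult_carrier_mat[of _ 2 2 _ 2])
qed

section \<open>Pauli rotations\<close>

lemma gmsable_scalar:
  assumes "unitary_mat (2 ^ n) (k \<cdot>\<^sub>m 1\<^sub>m (2 ^ n))"
  shows "gmsable n 0 (k \<cdot>\<^sub>m 1\<^sub>m (2 ^ n))"
proof (rule gmsable_smult[OF gmsable_one])
  have "mat_adjoint (k \<cdot>\<^sub>m 1\<^sub>m (2 ^ n)) * (k \<cdot>\<^sub>m 1\<^sub>m (2 ^ n)) = (cnj k * k) \<cdot>\<^sub>m (1\<^sub>m (2 ^ n) :: complex mat)"
    by (simp only: mat_adjoint_smult mat_adjoint_one smult_mult_smult[OF one_carrier_mat one_carrier_mat] left_mult_one_mat[OF one_carrier_mat])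
  then have "(cnj k * k) \<cdot>\<^sub>m (1\<^sub>m (2 ^ n) :: complex mat) = 1\<^sub>m (2 ^ n)"
    using unitary_matD(3)[OF assms] by simp
  then have "((cnj k * k) \<cdot>\<^sub>m (1\<^sub>m (2 ^ n) :: complex mat)) $$ (0, 0) = 1\<^sub>m (2 ^ n) $$ (0, 0)" by (simp only:)
  then have "k * cnj k = 1" by (simp add: mult.commute)
  then have "complex_of_real ((cmod k)\<^sup>2) = 1" by (simp only: complex_norm_square)
  then have "(cmod k)\<^sup>2 = 1" by (simp only: of_real_eq_1_iff)
  then show "cmod k = 1" by (simp add: power2_eq_1_iff) (metis norm_ge_zero neg_0_le_iff_le not_one_le_zero)
qed

lemma unitary_mat_conj_by:
  "unitary_mat d C \<Longrightarrow> unitary_mat d P \<Longrightarrow> unitary_mat d (conj_by C P)"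
  unfolding conj_by_def by (intro unitary_mat_mult unitary_mat_adjoint)

text \<open>Conjugation is linear, so the \<open>V\<close> reducing \<open>F\<close> to a multiple
  of \<open>X\<close> on \<open>v\<close> turns the whole combination into a one-qubit operator,
  which inherits unitarity. The coefficients are free, so this covers both the phase gates and the
  Clifford rotations used later.\<close>

lemma pauli_rotation:
  assumes F: "F \<in> paulis n" and un: "unitary_mat (2 ^ n) (\<alpha> \<cdot>\<^sub>m 1\<^sub>m (2 ^ n) + \<beta> \<cdot>\<^sub>m F)"
  obtains V where "clifford n V" "gmsable n 2 V" "gmsable n 2 (mat_adjoint V)"
    "gmsable n 0 (conj_by V (\<alpha> \<cdot>\<^sub>m 1\<^sub>m (2 ^ n) + \<beta> \<cdot>\<^sub>m F))"
proof -
  obtain c a b where Fc: "F = c \<cdot>\<^sub>m pauli n a b" using F by (rule paulisE)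
  let ?R = "\<alpha> \<cdot>\<^sub>m 1\<^sub>m (2 ^ n) + \<beta> \<cdot>\<^sub>m F"
  show ?thesis
  proof (cases "\<exists>v<n. a v \<or> b v")
    case False
    \<comment> \<open>An operator without support offers no qubit \<open>v\<close>; here the
      combination is a scalar and \<open>V\<close> is the identity.\<close>
    then have "pauli n a b = 1\<^sub>m (2 ^ n)"
      unfolding pauli_one[symmetric] by (intro pauli_cong) auto
    then have R: "?R = (\<alpha> + \<beta> * c) \<cdot>\<^sub>m 1\<^sub>m (2 ^ n)"
      unfolding Fc by (simp add: smult_smult_mat add_smult_distrib_right_mat[OF one_carrier_mat])
    have "conj_by (1\<^sub>m (2 ^ n)) ?R = ?R"
      using unitary_matD(1)[OF un] by (simp only: conj_by_def mat_adjoint_one left_mult_one_mat right_mult_one_mat)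
    moreover have "gmsable n 0 ?R"
      using gmsable_scalar[of n "\<alpha> + \<beta> * c"] un unfolding R .
    ultimately show ?thesis
      using that[OF clifford_one] gmsable_mono[OF gmsable_one, of 2 n] by (simp add: mat_adjoint_one)
  next
    case True
    then obtain v where v: "v < n" "a v \<or> b v" by (elim exE conjE)
    obtain V d where V: "clifford n V" "gmsable n 2 V" "gmsable n 2 (mat_adjoint V)"
      and d: "conj_by V (pauli n a b) = d \<cdot>\<^sub>m pauli_x n v"
      using pauli_reduce[of v n a b, OF v] by (elim exE conjE)
    note u = clifford_unitary[OF V(1)]
    let ?U = "\<alpha> \<cdot>\<^sub>m 1\<^sub>m 2 + (\<beta> * (c * d)) \<cdot>\<^sub>m pauli_X"
    have "conj_by V ?R = \<alpha> \<cdot>\<^sub>m 1\<^sub>m (2 ^ n) + (\<beta> * (c * d)) \<cdot>\<^sub>m pauli_x n v"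
      using unitary_matD(1)[OF u] unfolding Fc
      by (simp add: conj_by_add[where d = "2 ^ n"] conj_by_smult[where d = "2 ^ n"] conj_by_one[OF u] d smult_smult_mat mult.assoc)
    also have "\<dots> = on_qubit n v ?U"
      by (simp add: on_qubit_linear on_qubit_one on_qubit_pauli_X v)
    finally have R: "conj_by V ?R = on_qubit n v ?U" .
    have "unitary_mat (2 ^ n) (on_qubit n v ?U)"
      unfolding R[symmetric] using u un by (rule unitary_mat_conj_by)
    then have "unitary_mat 2 ?U"
      using v(1) by (intro on_qubit_unitary_imp[of v n]) simp_all
    then have "gmsable n 0 (conj_by V ?R)"
      unfolding R using v(1) by (intro gmsable_on_qubit)
    then show ?thesis using that V by simp
  qed
qed

section \<open>Separating the phase gates from the Clifford operators\<close>

lemma zphase_mat_linear: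
  assumes "q < n"
  shows "zphase_mat n q \<alpha> = complex_of_real (cos (\<alpha> / 2)) \<cdot>\<^sub>m 1\<^sub>m (2 ^ n) + (- \<i> * sin (\<alpha> / 2)) \<cdot>\<^sub>m pauli_z n q"
proof -
  have e: "exp (- \<i> * complex_of_real x * spin r q) =
      complex_of_real (cos x) + (- \<i> * complex_of_real (sin x)) * spin r q" for x r
    by (cases "bit r q") (simp_all add: spin_def exp_Euler exp_minus_Euler cos_of_real sin_of_real)
  have "zphase_mat n q \<alpha> = diagm n (\<lambda>r. complex_of_real (cos (\<alpha> / 2)) + (- \<i> * complex_of_real (sin (\<alpha> / 2))) * spin r q)"
    unfolding zphase_mat_eq[OF assms] e by (rule refl)
  also have "\<dots> = complex_of_real (cos (\<alpha> / 2)) \<cdot>\<^sub>m 1\<^sub>m (2 ^ n) + (- \<i> * complex_of_real (sin (\<alpha> / 2))) \<cdot>\<^sub>m diagm n (\<lambda>r. spin r q)"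
    by (rule eq_matI) (auto simp: diagm_def)
  finally show ?thesis using assms by (simp add: on_qubit_Z on_qubit_pauli_Z[symmetric])
qed

lemma zphase_mat_unitary: "q < n \<Longrightarrow> unitary_mat (2 ^ n) (zphase_mat n q \<alpha>)"
proof -
  assume "q < n"
  have "cmod (exp (- \<i> * complex_of_real x * spin r q)) = 1" for x r
    by (simp add: spin_def)
  then show ?thesis unfolding zphase_mat_eq[OF \<open>q < n\<close>] by (intro diagm_unitary)
qed

text \<open>\<open>C\<close> collects the Clifford operators already passed, \<open>gs\<close> is
  the rest of the circuit. \<open>C\<close> is arbitrary in the induction because each gate changes
  it; everything paid for accumulates in \<open>W\<close>, which acts before
  \<open>C'\<close>.\<close>

lemma clifford_phase_decompose:
  assumes "clifford n C" "\<forall>g\<in>set gs. valid_gate n g \<and> (clifford_gate g \<or> non_clifford_phase g)"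
  shows "\<exists>C' W. clifford n C' \<and> gmsable n (2 * length (filter non_clifford_phase gs)) W \<and> circuit_mat n gs * C = C' * W"
  using assms
proof (induction gs arbitrary: C)
  case Nil
  have "1\<^sub>m (2 ^ n) * C = C * 1\<^sub>m (2 ^ n)"
    using unitary_matD(1)[OF clifford_unitary[OF Nil(1)]] by simp
  then show ?case using Nil(1) gmsable_one by (intro exI[of _ C] exI[of _ "1\<^sub>m (2 ^ n)"]) simp
next
  case (Cons g gs)
  note C = unitary_matD(1)[OF clifford_unitary[OF Cons.prems(1)]]
  have split: "circuit_mat n (g # gs) * D = circuit_mat n gs * (gate_mat n g * D)" if "D \<in> carrier_mat (2 ^ n) (2 ^ n)" for D
    by (simp add: assoc_mult_mat[OF circuit_mat_carrier gate_mat_carrier that])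
  have gs: "\<forall>g\<in>set gs. valid_gate n g \<and> (clifford_gate g \<or> non_clifford_phase g)"
    and g: "valid_gate n g" "clifford_gate g \<or> non_clifford_phase g" using Cons.prems(2) by simp_all
  show ?case
  proof (cases "clifford_gate g")
    case True
    then have "clifford n (gate_mat n g * C)" "\<not> non_clifford_phase g"
      using clifford_mult[OF clifford_gate_mat[OF g(1)] Cons.prems(1)] by (cases g; simp)+
    then show ?thesis using Cons.IH[of "gate_mat n g * C"] gs split[OF C] by simp
  next
    case False
    then obtain q \<alpha> where gq: "g = ZPhase q \<alpha>" and ncp: "non_clifford_phase g"
      using g(2) by (cases g) auto
    then have q: "q < n" using g(1) by simp
    let ?G = "gate_mat n g" and ?F = "conj_by C (pauli_z n q)"
    have G: "?G \<in> carrier_mat (2 ^ n) (2 ^ n)" by (rule gate_mat_carrier)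
    have cG: "conj_by C ?G = complex_of_real (cos (\<alpha> / 2)) \<cdot>\<^sub>m 1\<^sub>m (2 ^ n) + (- \<i> * sin (\<alpha> / 2)) \<cdot>\<^sub>m ?F"
      using C unfolding gq gate_mat.simps zphase_mat_linear[OF q]
      by (simp add: conj_by_add[where d = "2 ^ n"] conj_by_smult[where d = "2 ^ n"] conj_by_one[OF clifford_unitary[OF Cons.prems(1)]])
    have uG: "unitary_mat (2 ^ n) (conj_by C ?G)"
      unfolding gq gate_mat.simps
      by (intro unitary_mat_conj_by clifford_unitary Cons.prems(1) zphase_mat_unitary q)
    have "?F \<in> paulis n" by (intro clifford_conj Cons.prems(1) pauli_in_paulis)
    then obtain V where V: "clifford n V" "gmsable n 2 V" "gmsable n 2 (mat_adjoint V)"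
      "gmsable n 0 (conj_by V (conj_by C ?G))"
      using uG unfolding cG by (rule pauli_rotation)
    let ?L = "conj_by V (conj_by C ?G)"
    note v = unitary_matD[OF clifford_unitary[OF V(1)]]
    have L: "?L \<in> carrier_mat (2 ^ n) (2 ^ n)" using gmsable_unitary[OF V(4)] by (rule unitary_matD(1))
    have "?G * C = C * conj_by C ?G"
      by (rule mult_conj_by[symmetric, OF clifford_unitary[OF Cons.prems(1)] G])
    also have "conj_by C ?G = V * ?L * mat_adjoint V"
    proof -
      have "V * ?L * mat_adjoint V = conj_by C ?G * V * mat_adjoint V"
        using mult_conj_by[OF clifford_unitary[OF V(1)] unitary_matD(1)[OF uG]] by simp
      also have "\<dots> = conj_by C ?G"
        using unitary_matD(1)[OF uG] by (simp add: assoc_mult_mat[OF _ v(1,2)] v(4))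
      finally show ?thesis ..
    qed
    \<comment> \<open>\<open>V\<close> is regrouped with \<open>C\<close> and stays Clifford, so
      only \<open>mat_adjoint V\<close> costs two global gates; the one-qubit operator
      \<open>?L\<close> is free.\<close>
    also have "C * (V * ?L * mat_adjoint V) = (C * V) * (?L * mat_adjoint V)"
      using C v(1,2) L by (simp add: assoc_mult_mat[of _ "2 ^ n" "2 ^ n" _ "2 ^ n" _ "2 ^ n"] mult_carrier_mat[of _ "2 ^ n" "2 ^ n" _ "2 ^ n"])
    finally have GC: "?G * C = (C * V) * (?L * mat_adjoint V)" .
    have LV: "?L * mat_adjoint V \<in> carrier_mat (2 ^ n) (2 ^ n)" "C * V \<in> carrier_mat (2 ^ n) (2 ^ n)"
      using L v C by (auto intro: mult_carrier_mat)
    obtain C' W where W: "clifford n C'" "gmsable n (2 * length (filter non_clifford_phase gs)) W"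
      "circuit_mat n gs * (C * V) = C' * W"
      using Cons.IH[OF clifford_mult[OF Cons.prems(1) V(1)] gs] by (elim exE conjE)
    have "circuit_mat n (g # gs) * C = circuit_mat n gs * (C * V) * (?L * mat_adjoint V)"
      unfolding split[OF C] GC by (rule assoc_mult_mat[symmetric, OF circuit_mat_carrier LV(2,1)])
    also have "\<dots> = C' * (W * (?L * mat_adjoint V))"
      unfolding W(3)
      by (rule assoc_mult_mat[OF unitary_matD(1)[OF clifford_unitary[OF W(1)]] unitary_matD(1)[OF gmsable_unitary[OF W(2)]] LV(1)])
    finally have "circuit_mat n (g # gs) * C = C' * (W * (?L * mat_adjoint V))" .
    moreover have "gmsable n (2 * length (filter non_clifford_phase gs) + (0 + 2)) (W * (?L * mat_adjoint V))"
      by (intro gmsable_mult W V)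
    then have "gmsable n (2 * length (filter non_clifford_phase (g # gs))) (W * (?L * mat_adjoint V))"
      using ncp by simp
    ultimately show ?thesis using W(1) by (intro exI conjI)
  qed
qed

section \<open>Clifford operators from linearly many global gates\<close>

text \<open>The values used are \<open>e = 1\<close> for commuting and \<open>e = -1\<close> for
  anticommuting pairs. As a parameter, the sign multiplies along products and both cases are treated
  at once.\<close>

definition swaps :: "complex \<Rightarrow> complex mat \<Rightarrow> complex mat \<Rightarrow> bool" where
  "swaps e A B \<longleftrightarrow> A * B = e \<cdot>\<^sub>m (B * A)"

lemma swaps_mult:
  assumes c: "A \<in> carrier_mat d d" "B \<in> carrier_mat d d" "C \<in> carrier_mat d d"
    and s: "swaps e A B" "swaps f A C"
  shows "swaps (e * f) A (B * C)"
proof -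
  have "A * (B * C) = (A * B) * C" using c by simp
  also have "\<dots> = e \<cdot>\<^sub>m (B * (A * C))"
    using c s(1) by (simp add: swaps_def mult_smult_assoc_mat[of _ d d _ d] mult_carrier_mat[of _ d d _ d])
  also have "\<dots> = (e * f) \<cdot>\<^sub>m ((B * C) * A)"
    using c s(2) by (simp add: swaps_def mult_smult_distrib[of _ d d _ d] mult_carrier_mat[of _ d d _ d] smult_smult_mat)
  finally show ?thesis by (simp add: swaps_def)
qed

lemma swaps_sym: "swaps e A B \<Longrightarrow> e * e = 1 \<Longrightarrow> swaps e B A"
  by (simp add: swaps_def smult_smult_mat)

lemma swaps_smult:
  assumes "A \<in> carrier_mat d d" "B \<in> carrier_mat d d" "swaps e A B"
  shows "swaps e A (c \<cdot>\<^sub>m B)"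
  using assms by (simp add: swaps_def mult_smult_distrib[of _ d d _ d] mult_smult_assoc_mat[of _ d d _ d] smult_smult_mat mult.commute)

lemma swaps_conj_by:
  assumes "unitary_mat d C" "A \<in> carrier_mat d d" "B \<in> carrier_mat d d" "swaps e A B"
  shows "swaps e (conj_by C A) (conj_by C B)"
  using assms unfolding swaps_def
  by (simp add: conj_by_mult[symmetric, where d = d] conj_by_smult[where d = d, OF unitary_matD(1)] mult_carrier_mat[of _ d d _ d])

lemma swaps_cases: "P \<in> paulis n \<Longrightarrow> Q \<in> paulis n \<Longrightarrow> swaps 1 P Q \<or> swaps (-1) P Q"
  using paulis_commute[of Q n P] by (simp add: swaps_def)

text \<open>Both relations together would make \<open>A * B\<close> equal to its negative, hence
  zero, which a unitary matrix is not.\<close>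

lemma swaps_exclusive:
  assumes U: "unitary_mat (2 ^ n) A" "unitary_mat (2 ^ n) B" and s: "swaps 1 A B" "swaps (-1) A B"
  shows False
proof -
  let ?M = "A * B"
  note m = unitary_matD[OF unitary_mat_mult[OF U]]
  have "?M = -1 \<cdot>\<^sub>m ?M" using s by (simp add: swaps_def)
  then have z: "?M $$ (i, j) = - ?M $$ (i, j)" if "i < 2 ^ n" "j < 2 ^ n" for i j
    using that m(1) index_smult_mat(1)[of i ?M j "-1"]
    by (metis carrier_matD mult_minus1)
  have "?M = 0\<^sub>m (2 ^ n) (2 ^ n)"
  proof (rule eq_matI)
    fix i j assume "i < dim_row (0\<^sub>m (2 ^ n) (2 ^ n) :: complex mat)" "j < dim_col (0\<^sub>m (2 ^ n) (2 ^ n) :: complex mat)"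
    then show "?M $$ (i, j) = 0\<^sub>m (2 ^ n) (2 ^ n) $$ (i, j)"
      using z[of i j] by (simp del: index_mult_mat)
  qed (use m(1) in auto)
  then have "mat_adjoint ?M * ?M = 0\<^sub>m (2 ^ n) (2 ^ n)"
    using right_mult_zero_mat[OF m(2)] by (simp only:)
  then have "(1\<^sub>m (2 ^ n) :: complex mat) $$ (0, 0) = 0\<^sub>m (2 ^ n) (2 ^ n) $$ (0, 0)" unfolding m(3) by (simp only:)
  then show False by simp
qed

lemma swaps_x_x: "swaps 1 (pauli_x n p) (pauli_x n q)"
  unfolding swaps_def pauli_mult by simp (rule pauli_cong, auto)

lemma swaps_z_z: "swaps 1 (pauli_z n p) (pauli_z n q)"
  unfolding swaps_def pauli_mult by simp (rule pauli_cong, auto)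

lemma swaps_x_z: "p < n \<Longrightarrow> swaps (if p = q then -1 else 1) (pauli_x n p) (pauli_z n q)"
proof -
  assume p: "p < n"
  have "(\<Prod>r<n. if r = q \<and> r = p then -1 else 1 :: complex) = (if p = q then -1 else 1)"
  proof (cases "p = q")
    case True
    then show ?thesis using p prod.delta[of "{..<n}" p "\<lambda>_. -1 :: complex"] by simp
  next
    case False
    then have "(\<Prod>r<n. if r = q \<and> r = p then -1 else 1 :: complex) = 1"
      by (intro prod.neutral) auto
    then show ?thesis using False by simp
  qed
  then show ?thesis
    unfolding swaps_def pauli_mult by (simp add: smult_smult_mat)
qed

lemma swaps_z_x: "p < n \<Longrightarrow> swaps (if p = q then -1 else 1) (pauli_z n q) (pauli_x n p)"
  by (rule swaps_sym[OF swaps_x_z]) auto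

text \<open>The Hermitian Pauli operators with eigenvalues among 1 and -1; this fixes the phase left
  free in \<open>paulis\<close> up to a sign.\<close>

definition pauli_inv :: "nat \<Rightarrow> complex mat \<Rightarrow> bool" where
  "pauli_inv n P \<longleftrightarrow> P \<in> paulis n \<and> unitary_mat (2 ^ n) P \<and> P * P = 1\<^sub>m (2 ^ n)"

lemma pauli_invD:
  assumes "pauli_inv n P"
  shows "P \<in> paulis n" "unitary_mat (2 ^ n) P" "P * P = 1\<^sub>m (2 ^ n)" "P \<in> carrier_mat (2 ^ n) (2 ^ n)"
  using assms paulis_carrier by (auto simp: pauli_inv_def)

lemma pauli_inv_x: "pauli_inv n (pauli_x n q)"
  by (simp add: pauli_inv_def pauli_unitary pauli_mult pauli_one)

lemma pauli_inv_z: "pauli_inv n (pauli_z n q)"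
  by (simp add: pauli_inv_def pauli_unitary pauli_mult pauli_one)

lemma pauli_inv_conj_by:
  assumes "clifford n C" "pauli_inv n P"
  shows "pauli_inv n (conj_by C P)"
  using pauli_invD[OF assms(2)] clifford_unitary[OF assms(1)] clifford_conj[OF assms(1)]
  by (auto simp: pauli_inv_def unitary_mat_conj_by conj_by_mult[symmetric, where d = "2 ^ n"] conj_by_one)

lemma mult_self_swaps:
  assumes A: "A \<in> carrier_mat d d" "A * A = 1\<^sub>m d" and B: "B \<in> carrier_mat d d" "B * B = 1\<^sub>m d" and s: "swaps e A B"
  shows "(A * B) * (A * B) = e \<cdot>\<^sub>m 1\<^sub>m d"
proof -
  have "(A * B) * (A * B) = e \<cdot>\<^sub>m ((B * A) * (A * B))"
    using A B s by (simp add: swaps_def mult_smult_assoc_mat[of _ d d _ d] mult_smult_distrib[of _ d d _ d] mult_carrier_mat[of _ d d _ d])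
  also have "(B * A) * (A * B) = 1\<^sub>m d"
    using mat_cancel_mid[OF B(1) A(1) A(1) B(1) A(2)] B(2) by simp
  finally show ?thesis .
qed

text \<open>The product \<open>A * B\<close> squares to \<open>e\<close>, so \<open>c\<close>
  repairs the square: 1 suits a commuting pair and \<i> an anticommuting one.\<close>

lemma pauli_inv_mult:
  assumes A: "pauli_inv n A" and B: "pauli_inv n B" and s: "swaps e A B" and c: "c * c * e = 1" "cmod c = 1"
  shows "pauli_inv n (c \<cdot>\<^sub>m (A * B))"
proof -
  note a = pauli_invD[OF A] and b = pauli_invD[OF B]
  have "(c \<cdot>\<^sub>m (A * B)) * (c \<cdot>\<^sub>m (A * B)) = (c * c * e) \<cdot>\<^sub>m 1\<^sub>m (2 ^ n)"
    unfolding smult_mult_smult[OF mult_carrier_mat[OF a(4) b(4)] mult_carrier_mat[OF a(4) b(4)]]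
      mult_self_swaps[OF a(4,3) b(4,3) s] smult_smult_mat ..
  then have "(c \<cdot>\<^sub>m (A * B)) * (c \<cdot>\<^sub>m (A * B)) = 1\<^sub>m (2 ^ n)" unfolding c(1) by simp
  then show ?thesis
    unfolding pauli_inv_def using a b c(2) by (intro conjI smult_in_paulis paulis_mult unitary_mat_smult unitary_mat_mult)
qed

lemma mult_lin_left:
  fixes x y :: complex
  assumes "F \<in> carrier_mat d d" "M \<in> carrier_mat d d"
  shows "(x \<cdot>\<^sub>m 1\<^sub>m d + y \<cdot>\<^sub>m F) * M = x \<cdot>\<^sub>m M + y \<cdot>\<^sub>m (F * M)"
  using assms by (simp add: add_mult_distrib_mat[of _ d d _ _ d] mult_smult_assoc_mat[of _ d d _ d])

lemma mult_lin_right: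
  fixes x y :: complex
  assumes "F \<in> carrier_mat d d" "M \<in> carrier_mat d d"
  shows "M * (x \<cdot>\<^sub>m 1\<^sub>m d + y \<cdot>\<^sub>m F) = x \<cdot>\<^sub>m M + y \<cdot>\<^sub>m (M * F)"
  using assms by (simp add: mult_add_distrib_mat[of _ d d _ d] mult_smult_distrib[of _ d d _ d])

lemma mat_adjoint_add:
  "A \<in> carrier_mat m n \<Longrightarrow> B \<in> carrier_mat m n \<Longrightarrow> mat_adjoint (A + B) = mat_adjoint A + mat_adjoint B" for A B :: "complex mat"
  by (rule eq_matI) auto

lemma conj_by_eqI:
  assumes "unitary_mat d K" "P \<in> carrier_mat d d" "T \<in> carrier_mat d d" "P * K = K * T"
  shows "conj_by K P = T"
proof -
  note k = unitary_matD[OF assms(1)]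
  have "conj_by K P = mat_adjoint K * (K * T)"
    unfolding conj_by_def assms(4)[symmetric] by (rule assoc_mult_mat[OF k(2) assms(2) k(1)])
  also have "\<dots> = (mat_adjoint K * K) * T"
    by (rule assoc_mult_mat[symmetric, OF k(2,1) assms(3)])
  finally show ?thesis using assms(3) by (simp add: k(3))
qed

lemma gmsable_pauli_rotation:
  assumes "F \<in> paulis n" "unitary_mat (2 ^ n) (\<alpha> \<cdot>\<^sub>m 1\<^sub>m (2 ^ n) + \<beta> \<cdot>\<^sub>m F)"
  shows "gmsable n 4 (\<alpha> \<cdot>\<^sub>m 1\<^sub>m (2 ^ n) + \<beta> \<cdot>\<^sub>m F)"
proof -
  let ?R = "\<alpha> \<cdot>\<^sub>m 1\<^sub>m (2 ^ n) + \<beta> \<cdot>\<^sub>m F"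
  obtain V where V: "clifford n V" "gmsable n 2 V" "gmsable n 2 (mat_adjoint V)" "gmsable n 0 (conj_by V ?R)"
    using assms by (rule pauli_rotation)
  have "gmsable n (2 + 0 + 2) (V * conj_by V ?R * mat_adjoint V)"
    by (intro gmsable_mult V)
  moreover have "V * conj_by V ?R * mat_adjoint V = ?R"
    using conj_by_cancel(1)[OF clifford_unitary[OF V(1)] unitary_matD(1)[OF assms(2)]]
    by (simp only: conj_by_def[of "mat_adjoint V"] mat_adjoint_adjoint)
  ultimately show ?thesis by simp
qed

text \<open>\<open>F = P * T\<close> squares to -1 and is anti-Hermitian, so \<open>K\<close>, the
  normalised \<open>1 + F\<close>, is unitary. Since \<open>P * F = T\<close> and
  \<open>F * T = P\<close>, both \<open>P * K\<close> and \<open>K * T\<close> are the normalised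
  \<open>P + T\<close>. An operator with the same sign against \<open>P\<close> and \<open>T\<close>
  commutes with \<open>F\<close>, hence with \<open>K\<close>.\<close>

lemma pauli_move:
  assumes P: "pauli_inv n P" and T: "pauli_inv n T" and PT: "swaps (-1) P T"
  obtains K where "clifford n K" "gmsable n 4 (mat_adjoint K)" "conj_by K P = T"
    "\<And>H e. H \<in> carrier_mat (2 ^ n) (2 ^ n) \<Longrightarrow> e * e = 1 \<Longrightarrow> swaps e H P \<Longrightarrow> swaps e H T \<Longrightarrow> conj_by K H = H"
proof -
  let ?d = "2 ^ n :: nat"
  note p = pauli_invD[OF P] and t = pauli_invD[OF T]
  define F where "F = P * T"
  have F: "F \<in> carrier_mat ?d ?d" "F \<in> paulis n" "unitary_mat ?d F"
    unfolding F_def using p t by (auto intro: paulis_mult unitary_mat_mult)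
  have FF: "F * F = -1 \<cdot>\<^sub>m 1\<^sub>m ?d"
    unfolding F_def by (rule mult_self_swaps[OF p(4,3) t(4,3) PT])
  have Fadj: "mat_adjoint F = -1 \<cdot>\<^sub>m F"
    using F FF by (intro mat_adjoint_eqI[where d = ?d]) (simp_all add: mult_smult_distrib[of _ ?d ?d _ ?d] smult_smult_mat)
  define K where "K = inv_sqrt2 \<cdot>\<^sub>m 1\<^sub>m ?d + inv_sqrt2 \<cdot>\<^sub>m F"
  have K: "K \<in> carrier_mat ?d ?d" using F by (simp add: K_def)
  have Kadj: "mat_adjoint K = inv_sqrt2 \<cdot>\<^sub>m 1\<^sub>m ?d + (- inv_sqrt2) \<cdot>\<^sub>m F"
    unfolding K_def using F by (simp add: mat_adjoint_add[where m = ?d and n = ?d] mat_adjoint_smult mat_adjoint_one inv_sqrt2_sq Fadj smult_smult_mat)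
  have FK: "F * K = inv_sqrt2 \<cdot>\<^sub>m F + (- inv_sqrt2) \<cdot>\<^sub>m 1\<^sub>m ?d" "K * F = inv_sqrt2 \<cdot>\<^sub>m F + (- inv_sqrt2) \<cdot>\<^sub>m 1\<^sub>m ?d"
    unfolding K_def using F by (simp_all add: mult_lin_left mult_lin_right FF smult_smult_mat)
  \<comment> \<open>Unitarity entry by entry, with \<open>x\<close> an entry of the identity and
    \<open>y\<close> of \<open>F\<close>; both orders of the product reduce to this one
    combination.\<close>
  have "inv_sqrt2 * (inv_sqrt2 * x + inv_sqrt2 * y) + - inv_sqrt2 * (inv_sqrt2 * y + - inv_sqrt2 * x) = x" for x y
  proof -
    have "inv_sqrt2 * (inv_sqrt2 * x + inv_sqrt2 * y) + - inv_sqrt2 * (inv_sqrt2 * y + - inv_sqrt2 * x) = 2 * (inv_sqrt2 * inv_sqrt2) * x" by (simp add: algebra_simps)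
    then show ?thesis by (simp add: inv_sqrt2_sq)
  qed
  then have "inv_sqrt2 \<cdot>\<^sub>m K + (- inv_sqrt2) \<cdot>\<^sub>m (inv_sqrt2 \<cdot>\<^sub>m F + (- inv_sqrt2) \<cdot>\<^sub>m 1\<^sub>m ?d) = 1\<^sub>m ?d"
    using F K unfolding K_def by (intro eq_matI) auto
  then have "mat_adjoint K * K = 1\<^sub>m ?d" "K * mat_adjoint K = 1\<^sub>m ?d"
    unfolding Kadj mult_lin_left[OF F(1) K] mult_lin_right[OF F(1) K] FK by simp_all
  then have U: "unitary_mat ?d K" using K by (simp add: unitary_mat_def)
  have fix1: "conj_by K H = H" if H: "H \<in> carrier_mat ?d ?d" "swaps 1 H F" for H
  proof (rule conj_by_eqI[OF U H(1) H(1)])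
    have "H * F = F * H" using H(2) by (simp add: swaps_def)
    then show "H * K = K * H"
      unfolding K_def mult_lin_left[OF F(1) H(1)] mult_lin_right[OF F(1) H(1)] by simp
  qed
  have cliff: "clifford n K"
    unfolding clifford_def
  proof (intro conjI ballI U)
    fix G assume G: "G \<in> paulis n"
    note g = paulis_carrier[OF G]
    have gF: "G * F \<in> carrier_mat ?d ?d" using g F(1) by (rule mult_carrier_mat)
    from swaps_cases[OF G F(2)] show "conj_by K G \<in> paulis n"
    proof
      assume "swaps 1 G F"
      then show ?thesis using fix1[OF g] G by simp
    next
      assume s: "swaps (-1) G F"
      have "F * (G * F) = (F * G) * F"
        by (rule assoc_mult_mat[symmetric, OF F(1) g F(1)])
      also have "F * G = -1 \<cdot>\<^sub>m (G * F)" using swaps_sym[OF s] by (simp add: swaps_def)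
      also have "(-1 \<cdot>\<^sub>m (G * F)) * F = -1 \<cdot>\<^sub>m (G * (F * F))"
        using g F(1) by (simp add: mult_smult_assoc_mat[of _ ?d ?d _ ?d] mult_carrier_mat[of _ ?d ?d _ ?d])
      also have "\<dots> = G" unfolding FF using g by (simp add: mult_smult_distrib[of _ ?d ?d _ ?d] smult_smult_mat)
      finally have FGF: "F * (G * F) = G" .
      \<comment> \<open>If \<open>G\<close> anticommutes with \<open>F\<close>, then
        \<open>F * (G * F) = G\<close>, so the two sides agree and conjugation sends
        \<open>G\<close> to the Pauli operator \<open>G * F\<close>.\<close>
      have "G * K = K * (G * F)"
        unfolding K_def mult_lin_left[OF F(1) gF] mult_lin_right[OF F(1) g] FGF
        using g gF by (intro comm_add_mat[of _ ?d ?d]) auto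
      then have "conj_by K G = G * F" by (rule conj_by_eqI[OF U g gF])
      then show ?thesis using G F(2) by (simp add: paulis_mult)
    qed
  qed
  have move: "conj_by K P = T"
  proof (rule conj_by_eqI[OF U p(4) t(4)])
    have "P * F = T" unfolding F_def using p(3) t(4) by (simp add: assoc_mult_mat[symmetric, OF p(4,4) t(4)])
    moreover have "F * T = P" unfolding F_def using t(3) p(4) by (simp add: assoc_mult_mat[OF p(4) t(4,4)])
    ultimately show "P * K = K * T"
      unfolding K_def mult_lin_left[OF F(1) t(4)] mult_lin_right[OF F(1) p(4)]
      using p(4) t(4) by (simp only:) (intro comm_add_mat[of _ ?d ?d], auto)
  qed
  have "gmsable n 4 (mat_adjoint K)"
    using gmsable_pauli_rotation[OF F(2), of inv_sqrt2 "- inv_sqrt2"] unitary_mat_adjoint[OF U] unfolding Kadj .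
  then show ?thesis
  proof (rule that[OF cliff _ move])
    fix H e assume H: "H \<in> carrier_mat ?d ?d" "e * e = 1" "swaps e H P" "swaps e H T"
    have "swaps (e * e) H F" unfolding F_def by (rule swaps_mult[OF H(1) p(4) t(4) H(3,4)])
    then show "conj_by K H = H" using fix1 H by simp
  qed
qed

text \<open>Appending the rotation of \<open>pauli_move\<close> to \<open>C\<close> redirects the
  image of \<open>G\<close> to \<open>T\<close>, and undoing it costs four global gates. The image
  of \<open>H\<close> survives when its sign against \<open>T\<close> equals that of
  \<open>H\<close> against \<open>G\<close>; the sign against the old image of \<open>G\<close> is
  preserved by conjugation.\<close>

lemma clifford_move:
  assumes C: "clifford n C" and G: "pauli_inv n G" and T: "pauli_inv n T" and GT: "swaps (-1) (conj_by C G) T"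
  obtains C1 where "clifford n C1" "conj_by C1 G = T"
    "\<And>H e. H \<in> carrier_mat (2 ^ n) (2 ^ n) \<Longrightarrow> e * e = 1 \<Longrightarrow> swaps e H G \<Longrightarrow> swaps e (conj_by C H) T \<Longrightarrow> conj_by C1 H = conj_by C H"
    "\<And>m. gmsable n m C1 \<Longrightarrow> gmsable n (m + 4) C"
proof -
  note u = clifford_unitary[OF C]
  obtain K where K: "clifford n K" "gmsable n 4 (mat_adjoint K)" "conj_by K (conj_by C G) = T"
    "\<And>H e. H \<in> carrier_mat (2 ^ n) (2 ^ n) \<Longrightarrow> e * e = 1 \<Longrightarrow> swaps e H (conj_by C G) \<Longrightarrow> swaps e H T \<Longrightarrow> conj_by K H = H"
    using pauli_move[OF pauli_inv_conj_by[OF C G] T GT] by blast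
  note k = unitary_matD[OF clifford_unitary[OF K(1)]]
  note comp = conj_by_comp[OF unitary_matD(1)[OF u] k(1)]
  show ?thesis
  proof (rule that[of "C * K"])
    show "clifford n (C * K)" by (rule clifford_mult[OF C K(1)])
    show "conj_by (C * K) G = T" using comp[OF pauli_invD(4)[OF G]] K(3) by simp
    show "gmsable n (m + 4) C" if "gmsable n m (C * K)" for m
    proof -
      have "(C * K) * mat_adjoint K = C"
        using unitary_matD(1)[OF u] by (simp add: assoc_mult_mat[OF _ k(1,2)] k(4))
      then show ?thesis using gmsable_mult[OF that K(2)] by simp
    qed
    show "conj_by (C * K) H = conj_by C H"
      if "H \<in> carrier_mat (2 ^ n) (2 ^ n)" "e * e = 1" "swaps e H G" "swaps e (conj_by C H) T" for H e
      unfolding comp[OF that(1)]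
      by (rule K(4)[OF conj_by_carrier[OF unitary_matD(1)[OF u] that(1)] that(2)
            swaps_conj_by[OF u that(1) pauli_invD(4)[OF G] that(3)] that(4)])
  qed
qed

text \<open>Commuting with every \<open>Z_q\<close> forces \<open>M\<close> to be diagonal;
  commuting with every \<open>X_q\<close> makes the diagonal invariant under bit flips, hence
  constant.\<close>

lemma paulis_centralizer:
  assumes M: "M \<in> carrier_mat (2 ^ n) (2 ^ n)"
    and x: "\<And>q. q < n \<Longrightarrow> M * pauli_x n q = pauli_x n q * M"
    and z: "\<And>q. q < n \<Longrightarrow> M * pauli_z n q = pauli_z n q * M"
  shows "M = M $$ (0, 0) \<cdot>\<^sub>m 1\<^sub>m (2 ^ n)"
proof -
  have off: "M $$ (r, c) = 0" if rc: "r < 2 ^ n" "c < 2 ^ n" "r \<noteq> c" for r c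
  proof -
    obtain q where q: "q < n" "bit r q \<noteq> bit c q" using bits_eq_iff[OF rc(1,2)] rc(3) by auto
    have "(M * diagm n (\<lambda>r. spin r q)) $$ (r, c) = (diagm n (\<lambda>r. spin r q) * M) $$ (r, c)"
      using z[OF q(1)] q(1) by (simp only: on_qubit_pauli_Z[symmetric] on_qubit_Z)
    then have "M $$ (r, c) * spin c q = spin r q * M $$ (r, c)"
      by (simp only: diagm_mult_left_index[OF M rc(1,2)] diagm_mult_right_index[OF M rc(1,2)])
    then show ?thesis using q(2) by (cases "bit r q") (simp_all add: spin_def)
  qed
  have D: "M = diagm n (\<lambda>r. M $$ (r, r))"
    using M off by (intro eq_matI) (auto simp: diagm_def)
  have step: "M $$ (r, r) = M $$ (c, c)"
    if rc: "r < 2 ^ n" "c < 2 ^ n" "q < n" "\<And>x. x < n \<Longrightarrow> (bit r x \<noteq> bit c x) = (x = q)" for r c q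
  proof -
    have "(diagm n (\<lambda>r. M $$ (r, r)) * pauli_x n q) $$ (r, c) = (pauli_x n q * diagm n (\<lambda>r. M $$ (r, r))) $$ (r, c)"
      using x[OF rc(3)] unfolding D[symmetric] by simp
    then show ?thesis
      unfolding diagm_mult_left_index[OF pauli_carrier rc(1,2)] diagm_mult_right_index[OF pauli_carrier rc(1,2)]
      using rc(4) by (simp add: pauli_index[OF rc(1,2)])
  qed
  have const: "M $$ (r, r) = M $$ (0, 0)" if "r < 2 ^ n" for r
    using that
  proof (induction r rule: less_induct)
    case (less r)
    show ?case
    proof (cases "r = 0")
      case False
      then obtain q where q: "q < n" "bit r q" using bits_eq_iff[OF less.prems, of 0] less.prems by auto
      \<comment> \<open>Clearing one set bit gives a smaller basis state that differs from
        \<open>r\<close> in bit \<open>q\<close> only, so the induction descends to 0.\<close>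
      let ?c = "unset_bit q r"
      have "int ?c \<le> int r" by (simp only: of_nat_unset_bit_eq unset_bit_less_eq)
      moreover have "?c \<noteq> r" using q(2) by (auto simp: bit_eq_iff bit_unset_bit_iff)
      ultimately have c: "?c < r" by simp
      then have "M $$ (r, r) = M $$ (?c, ?c)"
        using less.prems q by (intro step[of r ?c q]) (auto simp: bit_unset_bit_iff)
      also have "\<dots> = M $$ (0, 0)" using less.IH[OF c] c less.prems by simp
      finally show ?thesis .
    qed simp
  qed
  show ?thesis
  proof (rule eq_matI)
    fix i j assume "i < dim_row (M $$ (0, 0) \<cdot>\<^sub>m 1\<^sub>m (2 ^ n))" "j < dim_col (M $$ (0, 0) \<cdot>\<^sub>m 1\<^sub>m (2 ^ n))"
    then have ij: "i < 2 ^ n" "j < 2 ^ n" by auto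
    then show "M $$ (i, j) = (M $$ (0, 0) \<cdot>\<^sub>m 1\<^sub>m (2 ^ n)) $$ (i, j)"
      using off[OF ij] const[OF ij(1)] by (cases "i = j") auto
  qed (use M in auto)
qed

section \<open>Restoring the images of \<open>Z_q\<close> and \<open>X_q\<close>, one qubit after
  the other\<close>

definition fixes_below :: "nat \<Rightarrow> complex mat \<Rightarrow> nat \<Rightarrow> bool" where
  "fixes_below n C q \<longleftrightarrow> (\<forall>p<q. conj_by C (pauli_x n p) = pauli_x n p \<and> conj_by C (pauli_z n p) = pauli_z n p)"

text \<open>If the image \<open>?P\<close> anticommutes with \<open>Z_q\<close>, one move suffices.
  Otherwise the image goes through an operator \<open>R\<close> that anticommutes with both and
  commutes with all \<open>X_i\<close> and \<open>Z_i\<close> below \<open>q\<close>, so the images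
  already restored stay fixed. The bound 8 allows for two moves.\<close>

lemma clifford_fix_z:
  assumes C: "clifford n C" and fb: "fixes_below n C q" and q: "q < n"
  obtains C1 where "clifford n C1" "fixes_below n C1 q" "conj_by C1 (pauli_z n q) = pauli_z n q"
    "\<And>m. gmsable n m C1 \<Longrightarrow> gmsable n (m + 8) C"
proof -
  let ?X = "pauli_x n" and ?Z = "pauli_z n"
  let ?P = "conj_by C (?Z q)"
  have P: "pauli_inv n ?P" by (rule pauli_inv_conj_by[OF C pauli_inv_z])
  note p = pauli_invD[OF P] and u = clifford_unitary[OF C]
  have low: "swaps 1 (?X i) (?Z q)" "swaps 1 (?Z i) (?Z q)" if "i < q" for i
    using swaps_x_z[of i n q] swaps_z_z that q by auto
  have lowP: "swaps 1 (?X i) ?P" "swaps 1 (?Z i) ?P" if "i < q" for i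
    using swaps_conj_by[OF u pauli_carrier pauli_carrier low(1)[OF that]]
      swaps_conj_by[OF u pauli_carrier pauli_carrier low(2)[OF that]] fb that
    by (simp_all add: fixes_below_def)
  from swaps_cases[OF p(1) pauli_in_paulis[of n "\<lambda>_. False" "\<lambda>p. p = q"]] show ?thesis
  proof
    assume "swaps (-1) ?P (?Z q)"
    then obtain C1 where C1: "clifford n C1" "conj_by C1 (?Z q) = ?Z q"
      "\<And>H e. H \<in> carrier_mat (2 ^ n) (2 ^ n) \<Longrightarrow> e * e = 1 \<Longrightarrow> swaps e H (?Z q) \<Longrightarrow> swaps e (conj_by C H) (?Z q) \<Longrightarrow> conj_by C1 H = conj_by C H"
      "\<And>m. gmsable n m C1 \<Longrightarrow> gmsable n (m + 4) C"
      using clifford_move[OF C pauli_inv_z pauli_inv_z] by blast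
    have "fixes_below n C1 q"
      using fb low C1(3)[OF pauli_carrier, of 1] unfolding fixes_below_def by simp
    moreover have "gmsable n (m + 8) C" if "gmsable n m C1" for m
      using gmsable_mono[OF C1(4)[OF that]] by simp
    ultimately show ?thesis using that C1(1,2) by blast
  next
    assume comm: "swaps 1 ?P (?Z q)"
    \<comment> \<open>Otherwise \<open>?P\<close> would be a scalar, and so would
      \<open>Z_q\<close>, which anticommutes with \<open>X_q\<close>.\<close>
    have "\<exists>v<n. \<not> swaps 1 ?P (?X v) \<or> \<not> swaps 1 ?P (?Z v)"
    proof (rule ccontr)
      assume "\<not> (\<exists>v<n. \<not> swaps 1 ?P (?X v) \<or> \<not> swaps 1 ?P (?Z v))"
      then have "?P = ?P $$ (0, 0) \<cdot>\<^sub>m 1\<^sub>m (2 ^ n)"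
        by (intro paulis_centralizer[OF p(4)]) (simp_all add: swaps_def)
      then obtain k where k: "?P = k \<cdot>\<^sub>m 1\<^sub>m (2 ^ n)" by blast
      have "?Z q = conj_by (mat_adjoint C) (k \<cdot>\<^sub>m 1\<^sub>m (2 ^ n))"
        unfolding k[symmetric] by (rule conj_by_cancel(1)[symmetric, OF u pauli_carrier])
      also have "\<dots> = k \<cdot>\<^sub>m 1\<^sub>m (2 ^ n)"
        using unitary_matD(2)[OF u]
        by (simp add: conj_by_smult[where d = "2 ^ n"] conj_by_one[OF unitary_mat_adjoint[OF u]])
      finally have "?X q * ?Z q = ?Z q * ?X q"
        by (simp add: mult_smult_distrib[OF pauli_carrier one_carrier_mat] mult_smult_assoc_mat[OF one_carrier_mat pauli_carrier]
            left_mult_one_mat[OF pauli_carrier] right_mult_one_mat[OF pauli_carrier])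
      then have "swaps 1 (?X q) (?Z q)" by (simp add: swaps_def)
      then show False using swaps_exclusive[OF pauli_unitary pauli_unitary] swaps_x_z[OF q, of q] by auto
    qed
    then obtain v R1 where v: "v < n" "R1 = ?X v \<or> R1 = ?Z v" and "\<not> swaps 1 ?P R1" by blast
    have R1: "pauli_inv n R1" using v(2) pauli_inv_x pauli_inv_z by blast
    have anti: "swaps (-1) ?P R1"
      using swaps_cases[OF p(1) pauli_invD(1)[OF R1]] \<open>\<not> swaps 1 ?P R1\<close> by blast
    \<comment> \<open>\<open>?P\<close> commutes with the lower generators, being the image of
      \<open>Z_q\<close> under an operator that fixes them. Hence \<open>R1\<close> sits on a qubit
      from \<open>q\<close> on and itself commutes with them.\<close>
    have "\<not> v < q"
      using lowP[of v] swaps_sym[of 1] v(2) \<open>\<not> swaps 1 ?P R1\<close> by auto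
    then have lowR1: "swaps 1 (?X i) R1" "swaps 1 (?Z i) R1" if "i < q" for i
      using that v swaps_x_x swaps_z_z swaps_x_z[of i n v] swaps_z_x[of v n i] q by auto
    have "\<exists>R. pauli_inv n R \<and> swaps (-1) ?P R \<and> swaps (-1) R (?Z q) \<and> (\<forall>i<q. swaps 1 (?X i) R \<and> swaps 1 (?Z i) R)"
    proof (cases "swaps 1 R1 (?Z q)")
      case False
      then have "swaps (-1) R1 (?Z q)" using swaps_cases[OF pauli_invD(1)[OF R1] pauli_in_paulis] by blast
      then show ?thesis using R1 anti lowR1 by blast
    next
      case R1z: True
      have lowX: "swaps 1 (?X i) (?X q)" "swaps 1 (?Z i) (?X q)" if "i < q" for i
        using swaps_x_x swaps_z_x[OF q, of i] that by auto
      show ?thesis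
      proof (cases "swaps 1 ?P (?X q)")
        case False
        then have "swaps (-1) ?P (?X q)" using swaps_cases[OF p(1) pauli_in_paulis] by blast
        moreover have "swaps (-1) (?X q) (?Z q)" using swaps_x_z[OF q, of q] by simp
        ultimately show ?thesis using pauli_inv_x lowX by blast
      next
        case True
        \<comment> \<open>\<open>?P\<close> commutes with \<open>X_q\<close> and \<open>Z_q\<close>,
          so \<open>R1\<close> sits on another qubit. Multiplying it by \<open>X_q\<close> keeps the
          sign against \<open>?P\<close> and reverses the sign against \<open>Z_q\<close>, as
          \<open>R\<close> requires.\<close>
        then have "R1 \<noteq> ?X q" "R1 \<noteq> ?Z q" using comm \<open>\<not> swaps 1 ?P R1\<close> by auto
        then have RX: "swaps 1 R1 (?X q)"
          using v(2) swaps_x_x swaps_z_x[OF q, of v] by (cases "q = v") auto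
        let ?R = "1 \<cdot>\<^sub>m (R1 * ?X q)"
        note r = pauli_invD(4)[OF R1]
        have "pauli_inv n ?R"
          by (rule pauli_inv_mult[OF R1 pauli_inv_x RX]) simp_all
        moreover have "swaps (-1) ?P ?R"
          using swaps_mult[OF p(4) r pauli_carrier anti True] by simp
        moreover have "swaps (-1) (?Z q) ?R"
          using swaps_mult[OF pauli_carrier r pauli_carrier swaps_sym[OF R1z] swaps_z_x[OF q, of q]] by simp
        then have "swaps (-1) ?R (?Z q)" by (rule swaps_sym) simp
        moreover have "swaps 1 (?X i) ?R" "swaps 1 (?Z i) ?R" if "i < q" for i
          using swaps_mult[OF pauli_carrier r pauli_carrier lowR1(1)[OF that] lowX(1)[OF that]]
            swaps_mult[OF pauli_carrier r pauli_carrier lowR1(2)[OF that] lowX(2)[OF that]] by simp_all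
        ultimately show ?thesis by blast
      qed
    qed
    then obtain R where R: "pauli_inv n R" "swaps (-1) ?P R" "swaps (-1) R (?Z q)"
      "\<And>i. i < q \<Longrightarrow> swaps 1 (?X i) R" "\<And>i. i < q \<Longrightarrow> swaps 1 (?Z i) R" by blast
    obtain C1 where C1: "clifford n C1" "conj_by C1 (?Z q) = R"
      "\<And>H e. H \<in> carrier_mat (2 ^ n) (2 ^ n) \<Longrightarrow> e * e = 1 \<Longrightarrow> swaps e H (?Z q) \<Longrightarrow> swaps e (conj_by C H) R \<Longrightarrow> conj_by C1 H = conj_by C H"
      "\<And>m. gmsable n m C1 \<Longrightarrow> gmsable n (m + 4) C"
      using clifford_move[OF C pauli_inv_z R(1,2)] by blast
    have fb1: "fixes_below n C1 q"
      using fb low R(4,5) C1(3)[OF pauli_carrier, of 1] unfolding fixes_below_def by simp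
    obtain C2 where C2: "clifford n C2" "conj_by C2 (?Z q) = ?Z q"
      "\<And>H e. H \<in> carrier_mat (2 ^ n) (2 ^ n) \<Longrightarrow> e * e = 1 \<Longrightarrow> swaps e H (?Z q) \<Longrightarrow> swaps e (conj_by C1 H) (?Z q) \<Longrightarrow> conj_by C2 H = conj_by C1 H"
      "\<And>m. gmsable n m C2 \<Longrightarrow> gmsable n (m + 4) C1"
      using clifford_move[OF C1(1) pauli_inv_z pauli_inv_z R(3)[folded C1(2)]] by blast
    have "fixes_below n C2 q"
      using fb1 low C2(3)[OF pauli_carrier, of 1] unfolding fixes_below_def by simp
    moreover have "gmsable n (m + 8) C" if "gmsable n m C2" for m
      using C1(4)[OF C2(4)[OF that]] by (simp add: add.assoc)
    ultimately show ?thesis using that C2(1,2) by blast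
  qed
qed

text \<open>Every target must anticommute with \<open>Z_q\<close>, as \<open>X_q\<close> does, so
  that the restored \<open>Z_q\<close> stays fixed. If the image \<open>?Q\<close> commutes with
  \<open>X_q\<close>, the detour goes through the Pauli \<open>Y\<close> on
  \<open>q\<close>.\<close>

lemma clifford_fix_x:
  assumes C: "clifford n C" and fb: "fixes_below n C q" and q: "q < n" and cz: "conj_by C (pauli_z n q) = pauli_z n q"
  obtains C1 where "clifford n C1" "fixes_below n C1 (Suc q)" "\<And>m. gmsable n m C1 \<Longrightarrow> gmsable n (m + 8) C"
proof -
  let ?X = "pauli_x n" and ?Z = "pauli_z n"
  let ?Q = "conj_by C (?X q)"
  have Q: "pauli_inv n ?Q" by (rule pauli_inv_conj_by[OF C pauli_inv_x])
  note qq = pauli_invD[OF Q] and u = clifford_unitary[OF C]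
  have zx: "swaps (-1) (?Z q) (?X q)" and xz: "swaps (-1) (?X q) (?Z q)"
    using swaps_x_z[OF q, of q] swaps_z_x[OF q, of q] by simp_all
  have low: "swaps 1 (?X i) (?X q)" "swaps 1 (?Z i) (?X q)" "swaps 1 (?X i) (?Z q)" "swaps 1 (?Z i) (?Z q)" if "i < q" for i
    using swaps_x_x swaps_z_z swaps_z_x[OF q, of i] swaps_x_z[of i n q] that q by auto
  have Qz: "swaps (-1) ?Q (?Z q)"
    using swaps_conj_by[OF u pauli_carrier pauli_carrier xz] unfolding cz .
  have fixed: "fixes_below n C1 (Suc q)"
    if "fixes_below n C1 q" "conj_by C1 (?Z q) = ?Z q" "conj_by C1 (?X q) = ?X q" for C1
    using that by (auto simp: fixes_below_def less_Suc_eq)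
  from swaps_cases[OF qq(1) pauli_in_paulis[of n "\<lambda>p. p = q" "\<lambda>_. False"]] show ?thesis
  proof
    assume "swaps (-1) ?Q (?X q)"
    then obtain C1 where C1: "clifford n C1" "conj_by C1 (?X q) = ?X q"
      "\<And>H e. H \<in> carrier_mat (2 ^ n) (2 ^ n) \<Longrightarrow> e * e = 1 \<Longrightarrow> swaps e H (?X q) \<Longrightarrow> swaps e (conj_by C H) (?X q) \<Longrightarrow> conj_by C1 H = conj_by C H"
      "\<And>m. gmsable n m C1 \<Longrightarrow> gmsable n (m + 4) C"
      using clifford_move[OF C pauli_inv_x pauli_inv_x] by blast
    have "fixes_below n C1 q"
      using fb low C1(3)[OF pauli_carrier, of 1] unfolding fixes_below_def by simp
    moreover have "conj_by C1 (?Z q) = ?Z q"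
      using C1(3)[OF pauli_carrier, of "-1"] zx cz by simp
    ultimately have "fixes_below n C1 (Suc q)" using C1(2) by (rule fixed)
    moreover have "gmsable n (m + 8) C" if "gmsable n m C1" for m
      using gmsable_mono[OF C1(4)[OF that]] by simp
    ultimately show ?thesis using that C1(1) by blast
  next
    assume comm: "swaps 1 ?Q (?X q)"
    \<comment> \<open>The factor \<i> makes it an involution. It anticommutes with
      \<open>?Q\<close>, which anticommutes with \<open>Z_q\<close> only, and also with
      \<open>X_q\<close> and \<open>Z_q\<close>.\<close>
    let ?R = "\<i> \<cdot>\<^sub>m (?X q * ?Z q)"
    have XZ: "?X q * ?Z q \<in> carrier_mat (2 ^ n) (2 ^ n)" by (rule mult_carrier_mat[OF pauli_carrier pauli_carrier])
    have R: "pauli_inv n ?R" by (rule pauli_inv_mult[OF pauli_inv_x pauli_inv_z xz]) simp_all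
    have QR: "swaps (-1) ?Q ?R"
      using swaps_smult[OF qq(4) XZ swaps_mult[OF qq(4) pauli_carrier pauli_carrier comm Qz]] by simp
    have xR: "swaps (-1) (?X q) ?R"
      using swaps_smult[OF pauli_carrier XZ swaps_mult[OF pauli_carrier pauli_carrier pauli_carrier swaps_x_x xz]] by simp
    then have Rx: "swaps (-1) ?R (?X q)" by (rule swaps_sym) simp
    have zR: "swaps (-1) (?Z q) ?R"
      using swaps_smult[OF pauli_carrier XZ swaps_mult[OF pauli_carrier pauli_carrier pauli_carrier zx swaps_z_z]] by simp
    have lowR: "swaps 1 (?X i) ?R" "swaps 1 (?Z i) ?R" if "i < q" for i
      using swaps_smult[OF pauli_carrier XZ swaps_mult[OF pauli_carrier pauli_carrier pauli_carrier low(1)[OF that] low(3)[OF that]]]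
        swaps_smult[OF pauli_carrier XZ swaps_mult[OF pauli_carrier pauli_carrier pauli_carrier low(2)[OF that] low(4)[OF that]]]
      by simp_all
    obtain C1 where C1: "clifford n C1" "conj_by C1 (?X q) = ?R"
      "\<And>H e. H \<in> carrier_mat (2 ^ n) (2 ^ n) \<Longrightarrow> e * e = 1 \<Longrightarrow> swaps e H (?X q) \<Longrightarrow> swaps e (conj_by C H) ?R \<Longrightarrow> conj_by C1 H = conj_by C H"
      "\<And>m. gmsable n m C1 \<Longrightarrow> gmsable n (m + 4) C"
      using clifford_move[OF C pauli_inv_x R QR] by blast
    have fb1: "fixes_below n C1 q"
      using fb low lowR C1(3)[OF pauli_carrier, of 1] unfolding fixes_below_def by simp
    have cz1: "conj_by C1 (?Z q) = ?Z q"
      using C1(3)[OF pauli_carrier, of "-1"] zx zR cz by simp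
    obtain C2 where C2: "clifford n C2" "conj_by C2 (?X q) = ?X q"
      "\<And>H e. H \<in> carrier_mat (2 ^ n) (2 ^ n) \<Longrightarrow> e * e = 1 \<Longrightarrow> swaps e H (?X q) \<Longrightarrow> swaps e (conj_by C1 H) (?X q) \<Longrightarrow> conj_by C2 H = conj_by C1 H"
      "\<And>m. gmsable n m C2 \<Longrightarrow> gmsable n (m + 4) C1"
      using clifford_move[OF C1(1) pauli_inv_x pauli_inv_x Rx[folded C1(2)]] by blast
    have "fixes_below n C2 q"
      using fb1 low C2(3)[OF pauli_carrier, of 1] unfolding fixes_below_def by simp
    moreover have "conj_by C2 (?Z q) = ?Z q"
      using C2(3)[OF pauli_carrier, of "-1"] zx cz1 by simp
    ultimately have "fixes_below n C2 (Suc q)" using C2(2) by (rule fixed)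
    moreover have "gmsable n (m + 8) C" if "gmsable n m C2" for m
      using C1(4)[OF C2(4)[OF that]] by (simp add: add.assoc)
    ultimately show ?thesis using that C2(1) by blast
  qed
qed

text \<open>Induction from \<open>q = n\<close> downwards. At \<open>n\<close> the operator commutes
  with all generators and is a scalar; each earlier qubit adds 8 global gates for \<open>Z_q\<close>
  and 8 for \<open>X_q\<close>.\<close>

lemma gmsable_fixes_below:
  assumes "clifford n C" "fixes_below n C q" "q \<le> n"
  shows "gmsable n (16 * (n - q)) C"
  using assms(3,1,2)
proof (induction q arbitrary: C rule: inc_induct)
  case base
  note u = clifford_unitary[OF base(1)]
  have "C * P = P * C" if "conj_by C P = P" "P \<in> carrier_mat (2 ^ n) (2 ^ n)" for P
    using mult_conj_by[OF u that(2)] that(1) by simp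
  then have "C = C $$ (0, 0) \<cdot>\<^sub>m 1\<^sub>m (2 ^ n)"
    using base(2) by (intro paulis_centralizer[OF unitary_matD(1)[OF u]]) (simp_all add: fixes_below_def)
  then obtain k where "C = k \<cdot>\<^sub>m 1\<^sub>m (2 ^ n)" by blast
  then show ?case using gmsable_scalar[of n k] u by simp
next
  case (step q)
  obtain C1 where C1: "clifford n C1" "fixes_below n C1 q" "conj_by C1 (pauli_z n q) = pauli_z n q"
    "\<And>m. gmsable n m C1 \<Longrightarrow> gmsable n (m + 8) C"
    using clifford_fix_z[OF step.prems step.hyps(2)] by blast
  obtain C2 where C2: "clifford n C2" "fixes_below n C2 (Suc q)" "\<And>m. gmsable n m C2 \<Longrightarrow> gmsable n (m + 8) C1"
    using clifford_fix_x[OF C1(1,2) step.hyps(2) C1(3)] by blast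
  have "gmsable n (16 * (n - Suc q) + 8 + 8) C"
    by (intro C1(4) C2(3) step.IH C2(1,2))
  moreover have "16 * (n - Suc q) + 8 + 8 = 16 * (n - q)" using step.hyps(2) by simp
  ultimately show ?case by simp
qed

lemma gmsable_clifford: "clifford n C \<Longrightarrow> gmsable n (16 * n) C"
  using gmsable_fixes_below[of n C 0] by (simp add: fixes_below_def)

theorem theorem5p4:
  shows "\<exists>C::real. \<forall>n::nat. n \<ge> 2 \<longrightarrow>
    (\<forall>(N::nat) (gs::circuit). clifford_phase_circuit n N gs \<longrightarrow>
      (\<exists>hs::circuit. untargeted_gms_circuit n hs \<and> implements n hs gs \<and>
        real (gms_count n hs) \<le> 2 * real N + C * (real n)\<^sup>2 / ln (real n)))"
proof (intro exI[of _ 16] allI impI)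
  fix n N :: nat and gs :: circuit
  assume n: "n \<ge> 2" and gs: "clifford_phase_circuit n N gs"
  then have valid: "\<forall>g\<in>set gs. valid_gate n g \<and> (clifford_gate g \<or> non_clifford_phase g)"
    and N: "length (filter non_clifford_phase gs) = N"
    by (auto simp: clifford_phase_circuit_def valid_circuit_def)
  obtain C' W where W: "clifford n C'" "gmsable n (2 * N) W" "circuit_mat n gs * 1\<^sub>m (2 ^ n) = C' * W"
    using clifford_phase_decompose[OF clifford_one valid] unfolding N by (elim exE conjE)
  have "gmsable n (16 * n + 2 * N) (circuit_mat n gs)"
    using gmsable_mult[OF gmsable_clifford[OF W(1)] W(2)] W(3)
    by (simp add: right_mult_one_mat[OF circuit_mat_carrier])
  then obtain hs c where hs: "untargeted_gms_circuit n hs" "gms_count n hs \<le> 16 * n + 2 * N" "cmod c = 1"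
    "circuit_mat n gs = c \<cdot>\<^sub>m circuit_mat n hs"
    unfolding gmsable_def by blast
  \<comment> \<open>The unit scalar relates the circuits in the direction opposite to
    \<open>implements\<close>, so the phase is inverted.\<close>
  obtain \<theta> where "c = cis \<theta>" using hs(3) by (metis cis_Arg norm_eq_zero sgn_div_norm inverse_1 scaleR_one zero_neq_one)
  then have "circuit_mat n hs = cis (- \<theta>) \<cdot>\<^sub>m circuit_mat n gs"
    unfolding hs(4) smult_smult_mat by (simp add: cis_mult)
  then have "implements n hs gs" unfolding implements_def equal_up_to_phase_def by blast
  moreover have "real (gms_count n hs) \<le> 2 * real N + 16 * (real n)\<^sup>2 / ln (real n)"
  proof -
    \<comment> \<open>The constant 16 is the linear Clifford cost per qubit: \<open>n\<close> is at
      most \<open>n\<^sup>2 / ln n\<close> because \<open>ln n\<close> is positive and at most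
      \<open>n\<close>.\<close>
    have ln: "0 < ln (real n)" "ln (real n) \<le> real n" using n ln_le_minus_one[of "real n"] by (simp_all add: ln_gt_zero)
    have "16 * real n * ln (real n) \<le> 16 * (real n)\<^sup>2"
      using ln(2) by (simp add: power2_eq_square mult_left_mono)
    then have "16 * real n \<le> 16 * (real n)\<^sup>2 / ln (real n)"
      using ln(1) by (simp add: le_divide_eq)
    moreover have "real (gms_count n hs) \<le> real (16 * n + 2 * N)" using hs(2) by (simp only: of_nat_le_iff)
    ultimately show ?thesis by simp
  qed
  ultimately show "\<exists>hs. untargeted_gms_circuit n hs \<and> implements n hs gs \<and>
      real (gms_count n hs) \<le> 2 * real N + 16 * (real n)\<^sup>2 / ln (real n)"
    using hs(1) by blast
qed

end
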